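(* Let $\mathbb{X}$ be a distributive restriction category. Then $\mathbb{X}$ is classically classified if and only if there is a distributive category $\mathbb{D}$ such that $\mathbb{X}$ is restriction equivalent to the Kleisli category $\mathbb{D}_{\_\oplus\mathsf{1}}$ of the exception monad $\_\oplus\mathsf{1}$ on $\mathbb{D}$.
   Context: Composition is written in diagrammatic order: for $f:A\to B$ and $g:B\to C$, $fg:A\to C$ is first $f$, then $g$. **Restriction categories.** A restriction category is a category $\mathbb{X}$ with an operator assigning to each map $f:A\to B$ a map $\overline{f}:A\to A$ such that (whenever the expressions are well-typed) [R.1] $\overline{f}f=f$; [R.2] $\overline{f}\,\overline{g}=\overline{g}\,\overline{f}$; [R.3] $\overline{\overline{g}f}=\overline{g}\,\overline{f}$; [R.4] $f\overline{g}=\overline{fg}f$. A map $f:A\to B$ is total if $\overline{f}=1_A$. $\mathbb{X}$ has restriction zeroes if it has zero maps $0:A\to B$ for all $A,B$ (so $f0=0=0f$ for all $f$) and $\overline{0}=0$. **Distributive restriction categories.** A Cartesian restriction category is a restriction category with (a) a restriction terminal object: an object $\mathsf{1}$ such that for each $A$ there is a unique total map $t_A:A\to\mathsf{1}$, and $f t_B=\overline{f}t_A$ for every $f:A\to B$; and (b) binary restriction products: for all $A,B$ an object $A\times B$ with total maps $\pi_0:A\times B\to A$, $\pi_1:A\times B\to B$ such that for all $f:C\to A$, $g:C\to B$ there is a unique $\langle f,g\rangle:C\to A\times B$ with $\langle f,g\rangle\pi_0=\overline{g}f$ and $\langle f,g\rangle\pi_1=\overline{f}g$. A coCartesian restriction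 category is a restriction category with finite coproducts $\oplus$ (initial object $\mathsf{0}$ with unique maps $z_A:\mathsf{0}\to A$, injections $\iota_j$, copairing $[-,\dots,-]$) whose injections are all total. A distributive restriction category is a restriction category that is both Cartesian and coCartesian and such that the canonical maps $[1_A\times\iota_0,\,1_A\times\iota_1]:(A\times B)\oplus(A\times C)\to A\times(B\oplus C)$ and $\langle z_A,1_{\mathsf{0}}\rangle:\mathsf{0}\to A\times\mathsf{0}$ are isomorphisms, where $1_A\times h=\langle\pi_0,\pi_1h\rangle$. **Classically classified.** A distributive restriction category is classically classified if it has restriction zeroes and for every map $f:A\to B$ there is a unique total map $\mathcal{T}(f):A\to B\oplus\mathsf{1}$ with $\mathcal{T}(f)\,\iota_0^\circ=f$, where $\iota_0^\circ:=[1_B,0]:B\oplus\mathsf{1}\to B$. **Exception monad.** A distributive category $\mathbb{D}$ is a category with finite products ($\times$, terminal object $\mathsf{1}$) and finite coproducts ($\oplus$, initial object $\mathsf{0}$) such that the canonical maps $(A\times B)\oplus(A\times C)\to A\times(B\oplus C)$ and $\mathsf{0}\to A\times\mathsf{0}$ are isomorphisms. Its exception monad is $A\mapsto A\oplus\mathsf{1}$ with unit $\iota_0:A\to A\oplus\mathsf{1}$ and multiplication $[\iota_0,\iota_1,\iota_1]:A\oplus\mathsf{1}\oplus\mathsf{1}\to A\oplus\mathsf{1}$. Its Kleisli category $\mathbb{D}_{\_\oplus\mathsf{1}}$ has the objects of $\mathbb{D}$; a map $A\to B$ in it is a map $A\to B\oplus\mathsf{1}$ in $\mathbb{D}$; the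 identity on $A$ is $\iota_0$, and the composite of $f:A\to B\oplus\mathsf{1}$ and $g:B\to C\oplus\mathsf{1}$ is $f[g,\iota_1]$. It is a restriction category where the restriction of the Kleisli map given by $f:A\to B\oplus\mathsf{1}$ is the Kleisli map $A\to A$ given by the composite in $\mathbb{D}$: $A\xrightarrow{\langle 1_A,f\rangle}A\times(B\oplus\mathsf{1})\cong(A\times B)\oplus(A\times\mathsf{1})\xrightarrow{\pi_0\oplus\pi_1}A\oplus\mathsf{1}$. **Restriction equivalence.** An equivalence of categories between restriction categories such that the functors preserve the restriction operator and both the unit and counit have total components. *)

theory Defs
  imports Main
begin

text \<open>
  Composition is in diagrammatic order throughout: \<open>f \<cdot> g\<close> is first \<open>f\<close>, then \<open>g\<close>.
  All operations are total HOL functions; their values are only meaningful on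
  the objects and (composable) arrows of the category at hand.
\<close>

section \<open>Categories\<close>

record ('o, 'a) category =
  Obj :: "'o set"
  Arr :: "'a set"
  Dom :: "'a \<Rightarrow> 'o"
  Cod :: "'a \<Rightarrow> 'o"
  Id :: "'o \<Rightarrow> 'a"
  Comp :: "'a \<Rightarrow> 'a \<Rightarrow> 'a"  (infixl "\<cdot>\<index>" 70)

definition Hom :: "('o, 'a, 'm) category_scheme \<Rightarrow> 'o \<Rightarrow> 'o \<Rightarrow> 'a set" where
  "Hom C A B = {f \<in> Arr C. Dom C f = A \<and> Cod C f = B}"

locale category =
  fixes C :: "('o, 'a, 'm) category_scheme" (structure)
  assumes Dom_Obj: "f \<in> Arr C \<Longrightarrow> Dom C f \<in> Obj C"
    and Cod_Obj: "f \<in> Arr C \<Longrightarrow> Cod C f \<in> Obj C"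
    and Id_Hom: "A \<in> Obj C \<Longrightarrow> Id C A \<in> Hom C A A"
    and Comp_Hom: "f \<in> Hom C A B \<Longrightarrow> g \<in> Hom C B D \<Longrightarrow> f \<cdot> g \<in> Hom C A D"
    and Id_left: "f \<in> Hom C A B \<Longrightarrow> Id C A \<cdot> f = f"
    and Id_right: "f \<in> Hom C A B \<Longrightarrow> f \<cdot> Id C B = f"
    and Comp_assoc: "f \<in> Hom C A B \<Longrightarrow> g \<in> Hom C B D \<Longrightarrow> h \<in> Hom C D E \<Longrightarrow>
          (f \<cdot> g) \<cdot> h = f \<cdot> (g \<cdot> h)"

definition inverse_arrows :: "('o, 'a, 'm) category_scheme \<Rightarrow> 'a \<Rightarrow> 'a \<Rightarrow> bool" where
  "inverse_arrows C f g \<longleftrightarrow>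
     f \<in> Arr C \<and> g \<in> Hom C (Cod C f) (Dom C f) \<and>
     f \<cdot>\<^bsub>C\<^esub> g = Id C (Dom C f) \<and> g \<cdot>\<^bsub>C\<^esub> f = Id C (Cod C f)"

definition iso :: "('o, 'a, 'm) category_scheme \<Rightarrow> 'a \<Rightarrow> bool" where
  "iso C f \<longleftrightarrow> (\<exists>g. inverse_arrows C f g)"

definition inv_arrow :: "('o, 'a, 'm) category_scheme \<Rightarrow> 'a \<Rightarrow> 'a" where
  "inv_arrow C f = (THE g. inverse_arrows C f g)"


section \<open>Restriction categories\<close>

record ('o, 'a) restriction_category = "('o, 'a) category" +
  Rst :: "'a \<Rightarrow> 'a"  ("\<rho>\<index>")

locale restriction_category = category X
  for X :: "('o, 'a, 'm) restriction_category_scheme" (structure) +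
  assumes Rst_Hom: "f \<in> Hom X A B \<Longrightarrow> \<rho> f \<in> Hom X A A"
    and R1: "f \<in> Hom X A B \<Longrightarrow> \<rho> f \<cdot> f = f"
    and R2: "f \<in> Hom X A B \<Longrightarrow> g \<in> Hom X A C \<Longrightarrow> \<rho> f \<cdot> \<rho> g = \<rho> g \<cdot> \<rho> f"
    and R3: "f \<in> Hom X A B \<Longrightarrow> g \<in> Hom X A C \<Longrightarrow> \<rho> (\<rho> g \<cdot> f) = \<rho> g \<cdot> \<rho> f"
    and R4: "f \<in> Hom X A B \<Longrightarrow> g \<in> Hom X B C \<Longrightarrow> f \<cdot> \<rho> g = \<rho> (f \<cdot> g) \<cdot> f"

definition total :: "('o, 'a, 'm) restriction_category_scheme \<Rightarrow> 'a \<Rightarrow> bool" where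
  "total X f \<longleftrightarrow> \<rho>\<^bsub>X\<^esub> f = Id X (Dom X f)"

text \<open>\<open>z A B\<close> is the zero map from \<open>A\<close> to \<open>B\<close>.\<close>

definition restriction_zeroes ::
  "('o, 'a, 'm) restriction_category_scheme \<Rightarrow> ('o \<Rightarrow> 'o \<Rightarrow> 'a) \<Rightarrow> bool" where
  "restriction_zeroes X z \<longleftrightarrow>
     (\<forall>A\<in>Obj X. \<forall>B\<in>Obj X. z A B \<in> Hom X A B \<and> \<rho>\<^bsub>X\<^esub> (z A B) = z A A) \<and>
     (\<forall>A\<in>Obj X. \<forall>B\<in>Obj X. \<forall>C\<in>Obj X. \<forall>f\<in>Hom X A B.
        f \<cdot>\<^bsub>X\<^esub> z B C = z A C \<and> z C A \<cdot>\<^bsub>X\<^esub> f = z C B)"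


section \<open>Chosen products and coproducts\<close>

text \<open>
  The same record carries chosen products in the ordinary sense and chosen
  restriction products; the universal property is imposed by the locales below.
  The pairing \<open>Pair f g\<close> and the copairing \<open>Copair f g\<close> need no object arguments, since
  arrows determine their domain and codomain.
\<close>

record ('o, 'a) products =
  One :: 'o
  Bang :: "'o \<Rightarrow> 'a"
  Prod :: "'o \<Rightarrow> 'o \<Rightarrow> 'o"
  Pr0 :: "'o \<Rightarrow> 'o \<Rightarrow> 'a"
  Pr1 :: "'o \<Rightarrow> 'o \<Rightarrow> 'a"
  Pair :: "'a \<Rightarrow> 'a \<Rightarrow> 'a"

record ('o, 'a) coproducts =
  Zero :: 'o
  Init :: "'o \<Rightarrow> 'a"
  Sum :: "'o \<Rightarrow> 'o \<Rightarrow> 'o"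
  In0 :: "'o \<Rightarrow> 'o \<Rightarrow> 'a"
  In1 :: "'o \<Rightarrow> 'o \<Rightarrow> 'a"
  Copair :: "'a \<Rightarrow> 'a \<Rightarrow> 'a"

locale finite_products = category C
  for C :: "('o, 'a, 'm) category_scheme" (structure) +
  fixes P :: "('o, 'a) products"
  assumes One_Obj: "One P \<in> Obj C"
    and Bang_Hom: "A \<in> Obj C \<Longrightarrow> Bang P A \<in> Hom C A (One P)"
    and Bang_unique: "f \<in> Hom C A (One P) \<Longrightarrow> f = Bang P A"
    and Prod_Obj: "A \<in> Obj C \<Longrightarrow> B \<in> Obj C \<Longrightarrow> Prod P A B \<in> Obj C"
    and Pr0_Hom: "A \<in> Obj C \<Longrightarrow> B \<in> Obj C \<Longrightarrow> Pr0 P A B \<in> Hom C (Prod P A B) A"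
    and Pr1_Hom: "A \<in> Obj C \<Longrightarrow> B \<in> Obj C \<Longrightarrow> Pr1 P A B \<in> Hom C (Prod P A B) B"
    and Pair_Hom: "f \<in> Hom C D A \<Longrightarrow> g \<in> Hom C D B \<Longrightarrow> Pair P f g \<in> Hom C D (Prod P A B)"
    and Pair_Pr0: "f \<in> Hom C D A \<Longrightarrow> g \<in> Hom C D B \<Longrightarrow> Pair P f g \<cdot> Pr0 P A B = f"
    and Pair_Pr1: "f \<in> Hom C D A \<Longrightarrow> g \<in> Hom C D B \<Longrightarrow> Pair P f g \<cdot> Pr1 P A B = g"
    and Pair_unique: "f \<in> Hom C D A \<Longrightarrow> g \<in> Hom C D B \<Longrightarrow> h \<in> Hom C D (Prod P A B) \<Longrightarrow>
          h \<cdot> Pr0 P A B = f \<Longrightarrow> h \<cdot> Pr1 P A B = g \<Longrightarrow> h = Pair P f g"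

locale finite_coproducts = category C
  for C :: "('o, 'a, 'm) category_scheme" (structure) +
  fixes Q :: "('o, 'a) coproducts"
  assumes Zero_Obj: "Zero Q \<in> Obj C"
    and Init_Hom: "A \<in> Obj C \<Longrightarrow> Init Q A \<in> Hom C (Zero Q) A"
    and Init_unique: "f \<in> Hom C (Zero Q) A \<Longrightarrow> f = Init Q A"
    and Sum_Obj: "A \<in> Obj C \<Longrightarrow> B \<in> Obj C \<Longrightarrow> Sum Q A B \<in> Obj C"
    and In0_Hom: "A \<in> Obj C \<Longrightarrow> B \<in> Obj C \<Longrightarrow> In0 Q A B \<in> Hom C A (Sum Q A B)"
    and In1_Hom: "A \<in> Obj C \<Longrightarrow> B \<in> Obj C \<Longrightarrow> In1 Q A B \<in> Hom C B (Sum Q A B)"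
    and Copair_Hom: "f \<in> Hom C A D \<Longrightarrow> g \<in> Hom C B D \<Longrightarrow> Copair Q f g \<in> Hom C (Sum Q A B) D"
    and In0_Copair: "f \<in> Hom C A D \<Longrightarrow> g \<in> Hom C B D \<Longrightarrow> In0 Q A B \<cdot> Copair Q f g = f"
    and In1_Copair: "f \<in> Hom C A D \<Longrightarrow> g \<in> Hom C B D \<Longrightarrow> In1 Q A B \<cdot> Copair Q f g = g"
    and Copair_unique: "f \<in> Hom C A D \<Longrightarrow> g \<in> Hom C B D \<Longrightarrow> h \<in> Hom C (Sum Q A B) D \<Longrightarrow>
          In0 Q A B \<cdot> h = f \<Longrightarrow> In1 Q A B \<cdot> h = g \<Longrightarrow> h = Copair Q f g"

locale cartesian_restriction_category = restriction_category X
  for X :: "('o, 'a, 'm) restriction_category_scheme" (structure) +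
  fixes P :: "('o, 'a) products"
  assumes One_Obj: "One P \<in> Obj X"
    and Bang_Hom: "A \<in> Obj X \<Longrightarrow> Bang P A \<in> Hom X A (One P)"
    and Bang_total: "A \<in> Obj X \<Longrightarrow> total X (Bang P A)"
    and Bang_unique: "f \<in> Hom X A (One P) \<Longrightarrow> total X f \<Longrightarrow> f = Bang P A"
    and Bang_natural: "f \<in> Hom X A B \<Longrightarrow> f \<cdot> Bang P B = \<rho> f \<cdot> Bang P A"
    and Prod_Obj: "A \<in> Obj X \<Longrightarrow> B \<in> Obj X \<Longrightarrow> Prod P A B \<in> Obj X"
    and Pr0_Hom: "A \<in> Obj X \<Longrightarrow> B \<in> Obj X \<Longrightarrow> Pr0 P A B \<in> Hom X (Prod P A B) A"
    and Pr1_Hom: "A \<in> Obj X \<Longrightarrow> B \<in> Obj X \<Longrightarrow> Pr1 P A B \<in> Hom X (Prod P A B) B"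
    and Pr0_total: "A \<in> Obj X \<Longrightarrow> B \<in> Obj X \<Longrightarrow> total X (Pr0 P A B)"
    and Pr1_total: "A \<in> Obj X \<Longrightarrow> B \<in> Obj X \<Longrightarrow> total X (Pr1 P A B)"
    and Pair_Hom: "f \<in> Hom X D A \<Longrightarrow> g \<in> Hom X D B \<Longrightarrow> Pair P f g \<in> Hom X D (Prod P A B)"
    and Pair_Pr0: "f \<in> Hom X D A \<Longrightarrow> g \<in> Hom X D B \<Longrightarrow> Pair P f g \<cdot> Pr0 P A B = \<rho> g \<cdot> f"
    and Pair_Pr1: "f \<in> Hom X D A \<Longrightarrow> g \<in> Hom X D B \<Longrightarrow> Pair P f g \<cdot> Pr1 P A B = \<rho> f \<cdot> g"
    and Pair_unique: "f \<in> Hom X D A \<Longrightarrow> g \<in> Hom X D B \<Longrightarrow> h \<in> Hom X D (Prod P A B) \<Longrightarrow>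
          h \<cdot> Pr0 P A B = \<rho> g \<cdot> f \<Longrightarrow> h \<cdot> Pr1 P A B = \<rho> f \<cdot> g \<Longrightarrow> h = Pair P f g"

locale cocartesian_restriction_category =
  restriction_category X + finite_coproducts X Q
  for X :: "('o, 'a, 'm) restriction_category_scheme" (structure)
    and Q :: "('o, 'a) coproducts" +
  assumes In0_total: "A \<in> Obj X \<Longrightarrow> B \<in> Obj X \<Longrightarrow> total X (In0 Q A B)"
    and In1_total: "A \<in> Obj X \<Longrightarrow> B \<in> Obj X \<Longrightarrow> total X (In1 Q A B)"


section \<open>Distributivity\<close>

text \<open>\<open>1\<^sub>A \<times> h\<close>\<close>

definition id_times ::
  "('o, 'a, 'm) category_scheme \<Rightarrow> ('o, 'a) products \<Rightarrow> 'o \<Rightarrow> 'a \<Rightarrow> 'a" where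
  "id_times C P A h = Pair P (Pr0 P A (Dom C h)) (Pr1 P A (Dom C h) \<cdot>\<^bsub>C\<^esub> h)"

text \<open>\<open>f \<oplus> g\<close>\<close>

definition sum_arrow ::
  "('o, 'a, 'm) category_scheme \<Rightarrow> ('o, 'a) coproducts \<Rightarrow> 'a \<Rightarrow> 'a \<Rightarrow> 'a" where
  "sum_arrow C Q f g =
     Copair Q (f \<cdot>\<^bsub>C\<^esub> In0 Q (Cod C f) (Cod C g)) (g \<cdot>\<^bsub>C\<^esub> In1 Q (Cod C f) (Cod C g))"

text \<open>The canonical maps \<open>(A \<times> B) \<oplus> (A \<times> D) \<rightarrow> A \<times> (B \<oplus> D)\<close> and \<open>0 \<rightarrow> A \<times> 0\<close>\<close>

definition distributor ::
  "('o, 'a, 'm) category_scheme \<Rightarrow> ('o, 'a) products \<Rightarrow> ('o, 'a) coproducts \<Rightarrow>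
   'o \<Rightarrow> 'o \<Rightarrow> 'o \<Rightarrow> 'a" where
  "distributor C P Q A B D =
     Copair Q (id_times C P A (In0 Q B D)) (id_times C P A (In1 Q B D))"

definition nullary_distributor ::
  "('o, 'a, 'm) category_scheme \<Rightarrow> ('o, 'a) products \<Rightarrow> ('o, 'a) coproducts \<Rightarrow> 'o \<Rightarrow> 'a" where
  "nullary_distributor C P Q A = Pair P (Init Q A) (Id C (Zero Q))"

locale distributive_category =
  finite_products C P + finite_coproducts C Q
  for C :: "('o, 'a, 'm) category_scheme" (structure)
    and P :: "('o, 'a) products" and Q :: "('o, 'a) coproducts" +
  assumes distributor_iso:
      "A \<in> Obj C \<Longrightarrow> B \<in> Obj C \<Longrightarrow> D \<in> Obj C \<Longrightarrow> iso C (distributor C P Q A B D)"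
    and nullary_distributor_iso: "A \<in> Obj C \<Longrightarrow> iso C (nullary_distributor C P Q A)"

locale distributive_restriction_category =
  cartesian_restriction_category X P + cocartesian_restriction_category X Q
  for X :: "('o, 'a, 'm) restriction_category_scheme" (structure)
    and P :: "('o, 'a) products" and Q :: "('o, 'a) coproducts" +
  assumes distributor_iso:
      "A \<in> Obj X \<Longrightarrow> B \<in> Obj X \<Longrightarrow> D \<in> Obj X \<Longrightarrow> iso X (distributor X P Q A B D)"
    and nullary_distributor_iso: "A \<in> Obj X \<Longrightarrow> iso X (nullary_distributor X P Q A)"

text \<open>Zero maps are unique when they exist, so quantifying over \<open>z\<close> involves no choice.\<close>

definition classically_classified ::
  "('o, 'a, 'm) restriction_category_scheme \<Rightarrow> ('o, 'a) products \<Rightarrow> ('o, 'a) coproducts \<Rightarrow> bool" where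
  "classically_classified X P Q \<longleftrightarrow>
     (\<exists>z. restriction_zeroes X z \<and>
        (\<forall>A\<in>Obj X. \<forall>B\<in>Obj X. \<forall>f\<in>Hom X A B.
           \<exists>!T. T \<in> Hom X A (Sum Q B (One P)) \<and> total X T \<and>
                T \<cdot>\<^bsub>X\<^esub> Copair Q (Id X B) (z (One P) B) = f))"


section \<open>The Kleisli category of the exception monad\<close>

text \<open>
  A Kleisli map \<open>A \<rightarrow> B\<close> is a pair \<open>(f, B)\<close> with \<open>f : A \<rightarrow> B \<oplus> 1\<close>; the target \<open>B\<close> is
  recorded because it need not be determined by the object \<open>B \<oplus> 1\<close>.
\<close>

definition kleisli ::
  "('o, 'a, 'm) category_scheme \<Rightarrow> ('o, 'a) products \<Rightarrow> ('o, 'a) coproducts \<Rightarrow>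
   ('o, 'a \<times> 'o) restriction_category" where
  "kleisli D P Q =
     \<lparr> Obj = Obj D,
       Arr = {(f, B). B \<in> Obj D \<and> f \<in> Arr D \<and> Cod D f = Sum Q B (One P)},
       Dom = (\<lambda>(f, B). Dom D f),
       Cod = (\<lambda>(f, B). B),
       Id = (\<lambda>A. (In0 Q A (One P), A)),
       Comp = (\<lambda>(f, B) (g, C). (f \<cdot>\<^bsub>D\<^esub> Copair Q g (In1 Q C (One P)), C)),
       Rst = (\<lambda>(f, B). let A = Dom D f in
         (Pair P (Id D A) f
            \<cdot>\<^bsub>D\<^esub> inv_arrow D (distributor D P Q A B (One P))
            \<cdot>\<^bsub>D\<^esub> sum_arrow D Q (Pr0 P A B) (Pr1 P A (One P)), A)) \<rparr>"


section \<open>Restriction equivalence\<close>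

locale category_functor = source: category C + target: category D
  for C :: "('o, 'a, 'm) category_scheme" and D :: "('p, 'b, 'n) category_scheme" +
  fixes Fo :: "'o \<Rightarrow> 'p" and Fa :: "'a \<Rightarrow> 'b"
  assumes Fo_Obj: "A \<in> Obj C \<Longrightarrow> Fo A \<in> Obj D"
    and Fa_Hom: "f \<in> Hom C A B \<Longrightarrow> Fa f \<in> Hom D (Fo A) (Fo B)"
    and Fa_Id: "A \<in> Obj C \<Longrightarrow> Fa (Id C A) = Id D (Fo A)"
    and Fa_Comp: "f \<in> Hom C A B \<Longrightarrow> g \<in> Hom C B E \<Longrightarrow> Fa (f \<cdot>\<^bsub>C\<^esub> g) = Fa f \<cdot>\<^bsub>D\<^esub> Fa g"

locale restriction_functor =
  source: restriction_category X + target: restriction_category Y +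
  category_functor X Y Fo Fa
  for X :: "('o, 'a, 'm) restriction_category_scheme"
    and Y :: "('p, 'b, 'n) restriction_category_scheme"
    and Fo :: "'o \<Rightarrow> 'p" and Fa :: "'a \<Rightarrow> 'b" +
  assumes Fa_Rst: "f \<in> Arr X \<Longrightarrow> Fa (\<rho>\<^bsub>X\<^esub> f) = \<rho>\<^bsub>Y\<^esub> (Fa f)"

text \<open>A natural isomorphism \<open>\<alpha> : F \<Rightarrow> G\<close> between functors from \<open>C\<close> to \<open>D\<close>\<close>

definition natural_iso ::
  "('o, 'a, 'm) category_scheme \<Rightarrow> ('p, 'b, 'n) category_scheme \<Rightarrow>
   ('o \<Rightarrow> 'p) \<Rightarrow> ('a \<Rightarrow> 'b) \<Rightarrow> ('o \<Rightarrow> 'p) \<Rightarrow> ('a \<Rightarrow> 'b) \<Rightarrow> ('o \<Rightarrow> 'b) \<Rightarrow> bool" where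
  "natural_iso C D Fo Fa Go Ga \<alpha> \<longleftrightarrow>
     (\<forall>A\<in>Obj C. \<alpha> A \<in> Hom D (Fo A) (Go A) \<and> iso D (\<alpha> A)) \<and>
     (\<forall>A\<in>Obj C. \<forall>B\<in>Obj C. \<forall>f\<in>Hom C A B. Fa f \<cdot>\<^bsub>D\<^esub> \<alpha> B = \<alpha> A \<cdot>\<^bsub>D\<^esub> Ga f)"

definition restriction_equivalent ::
  "('o, 'a, 'm) restriction_category_scheme \<Rightarrow> ('p, 'b, 'n) restriction_category_scheme \<Rightarrow> bool" where
  "restriction_equivalent X Y \<longleftrightarrow>
     (\<exists>Fo Fa Go Ga \<eta> \<epsilon>.
        restriction_functor X Y Fo Fa \<and> restriction_functor Y X Go Ga \<and>
        natural_iso X X id id (Go \<circ> Fo) (Ga \<circ> Fa) \<eta> \<and> (\<forall>A\<in>Obj X. total X (\<eta> A)) \<and>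
        natural_iso Y Y (Fo \<circ> Go) (Fa \<circ> Ga) id id \<epsilon> \<and> (\<forall>B\<in>Obj Y. total Y (\<epsilon> B)))"

end

theory Submission
  imports Defs
begin

text \<open>
  From left to right, \<open>D\<close> is the subcategory of total maps of \<open>X\<close>. On total maps the
  restriction in the laws of restriction products disappears, so these become products, and the
  coproducts of \<open>X\<close> restrict as well because copairings of total maps are total; the
  canonical isomorphisms are total like every isomorphism
  (\<open>distributive_total_subcategory\<close>). A Kleisli map \<open>A \<rightarrow> B\<close> over this category is a total map
  \<open>A \<rightarrow> B \<oplus> 1\<close> of \<open>X\<close>, and classification says precisely that composing with
  \<open>[1, 0] : B \<oplus> 1 \<rightarrow> B\<close> is a bijection from these to all maps \<open>A \<rightarrow> B\<close> of \<open>X\<close>. What remains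
  is compatibility with the operations, and only the restriction needs an idea: under
  \<open>A \<times> (B \<oplus> 1) \<cong> (A \<times> B) \<oplus> (A \<times> 1)\<close> the partial projection \<open>[\<pi>\<^sub>0, 0]\<close> is \<open>\<pi>\<^sub>0\<close> restricted to
  where \<open>\<pi>\<^sub>1 [1, 0]\<close> is defined (\<open>distributor_Rst_retraction\<close>). Precomposing with the graph
  \<open>\<langle>1, f\<rangle>\<close> turns this into the domain of \<open>f [1, 0]\<close>. So \<open>X\<close> is even isomorphic to the
  Kleisli category.

  For the converse one would like total Kleisli maps to be the maps of \<open>D\<close>, but this
  fails: if \<open>D\<close> is a bounded distributive lattice, then \<open>B \<oplus> 1 = 1\<close> and every Kleisli map is
  total. What does hold is that a total Kleisli map \<open>T : A \<rightarrow> E \<oplus> 1\<close> factors through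
  \<open>\<iota>\<^sub>0\<close> as soon as \<open>E\<close> has a point \<open>c : 1 \<rightarrow> E\<close>, namely \<open>T = T [1, c] \<iota>\<^sub>0\<close>
  (\<open>total_kleisli_factors\<close>). Classifying maps have target \<open>E = B \<oplus> 1\<close>, which has the point
  \<open>\<iota>\<^sub>1\<close>, and this makes \<open>f \<iota>\<^sub>0\<close> the one and only classifying map of \<open>f : A \<rightarrow> B \<oplus> 1\<close>.
  Hence the Kleisli category is classified by coproducts with \<open>1\<close>
  (\<open>kleisli_classifying_coproducts\<close>), and this transports along the equivalence once the image
  of the coproduct \<open>B \<oplus> 1\<close> of \<open>X\<close> has been identified with the coproduct in the Kleisli
  category (\<open>sum_comparison\<close>).
\<close>

section \<open>Arrow calculus\<close>

text \<open>
  The laws below replace typings \<open>f \<in> Hom C A B\<close> by side conditions on domains and codomains,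
  so that they become conditional rewrite rules without extra variables in their premises.
  Composites are nested to the right, so the rules that evaluate injections and projections come
  with variants for the head of a longer composite.
\<close>

lemma Hom_iff: "f \<in> Hom C A B \<longleftrightarrow> f \<in> Arr C \<and> Dom C f = A \<and> Cod C f = B"
  by (auto simp: Hom_def)

context category
begin

declare Dom_Obj [simp] Cod_Obj [simp]

lemma Id_Arr [simp]: "A \<in> Obj C \<Longrightarrow> Id C A \<in> Arr C"
  and Dom_Id [simp]: "A \<in> Obj C \<Longrightarrow> Dom C (Id C A) = A"
  and Cod_Id [simp]: "A \<in> Obj C \<Longrightarrow> Cod C (Id C A) = A"
  using Id_Hom by (auto simp: Hom_iff)

lemma Comp_Arr [simp]: "f \<in> Arr C \<Longrightarrow> g \<in> Arr C \<Longrightarrow> Cod C f = Dom C g \<Longrightarrow> f \<cdot> g \<in> Arr C"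
  and Dom_Comp [simp]: "f \<in> Arr C \<Longrightarrow> g \<in> Arr C \<Longrightarrow> Cod C f = Dom C g \<Longrightarrow> Dom C (f \<cdot> g) = Dom C f"
  and Cod_Comp [simp]: "f \<in> Arr C \<Longrightarrow> g \<in> Arr C \<Longrightarrow> Cod C f = Dom C g \<Longrightarrow> Cod C (f \<cdot> g) = Cod C g"
  using Comp_Hom[of f "Dom C f" "Cod C f" g "Cod C g"] by (auto simp: Hom_iff)

lemma Id_Comp [simp]: "f \<in> Arr C \<Longrightarrow> Dom C f = A \<Longrightarrow> Id C A \<cdot> f = f"
  and Comp_Id [simp]: "f \<in> Arr C \<Longrightarrow> Cod C f = B \<Longrightarrow> f \<cdot> Id C B = f"
  using Id_left Id_right by (auto simp: Hom_iff)

lemma Comp_assoc_Arr [simp]: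
  "f \<in> Arr C \<Longrightarrow> g \<in> Arr C \<Longrightarrow> h \<in> Arr C \<Longrightarrow> Cod C f = Dom C g \<Longrightarrow> Cod C g = Dom C h \<Longrightarrow>
     (f \<cdot> g) \<cdot> h = f \<cdot> (g \<cdot> h)"
  using Comp_assoc by (auto simp: Hom_iff)

lemma inverse_arrows_unique:
  assumes "inverse_arrows C f g" "inverse_arrows C f h"
  shows "g = h"
proof -
  have "g = g \<cdot> (f \<cdot> h)" using assms by (auto simp: inverse_arrows_def Hom_iff)
  also have "\<dots> = (g \<cdot> f) \<cdot> h"
    by (rule Comp_assoc_Arr[symmetric]) (use assms in \<open>simp_all add: inverse_arrows_def Hom_iff\<close>)
  also have "\<dots> = h" using assms by (auto simp: inverse_arrows_def Hom_iff simp del: Comp_assoc_Arr)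
  finally show ?thesis .
qed

lemma inv_arrow_eq: "inverse_arrows C f g \<Longrightarrow> inv_arrow C f = g"
  unfolding inv_arrow_def using inverse_arrows_unique by blast

lemma inverse_arrows_inv_arrow: "iso C f \<Longrightarrow> inverse_arrows C f (inv_arrow C f)"
  using inv_arrow_eq by (auto simp: iso_def)

lemma inverse_arrows_sym: "inverse_arrows C f g \<Longrightarrow> inverse_arrows C g f"
  by (auto simp: inverse_arrows_def Hom_iff)

lemma isoE:
  assumes "iso C f" "f \<in> Hom C A B"
  obtains g where "g \<in> Hom C B A" "f \<cdot> g = Id C A" "g \<cdot> f = Id C B" "iso C g"
  using assms inverse_arrows_sym by (auto simp: iso_def inverse_arrows_def Hom_iff)

lemma isoI:
  assumes "f \<in> Hom C A B" "g \<in> Hom C B A" "f \<cdot> g = Id C A" "g \<cdot> f = Id C B"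
  shows "iso C f" "iso C g"
  using assms by (auto simp: iso_def inverse_arrows_def Hom_iff)

lemma iso_cancel_right:
  assumes "iso C e" "e \<in> Hom C B B'" "f \<in> Hom C A B" "g \<in> Hom C A B" "f \<cdot> e = g \<cdot> e"
  shows "f = g"
proof -
  obtain e' where "e' \<in> Hom C B' B" "e \<cdot> e' = Id C B" using isoE[OF assms(1,2)] by metis
  moreover have "f \<cdot> (e \<cdot> e') = g \<cdot> (e \<cdot> e')"
    using assms calculation(1) Comp_assoc_Arr[of f e e'] Comp_assoc_Arr[of g e e']
    by (simp add: Hom_iff del: Comp_assoc_Arr)
  ultimately show ?thesis using assms by (auto simp: Hom_iff)
qed

lemma iso_cancel_left:
  assumes "iso C e" "e \<in> Hom C A' A" "f \<in> Hom C A B" "g \<in> Hom C A B" "e \<cdot> f = e \<cdot> g"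
  shows "f = g"
proof -
  obtain e' where "e' \<in> Hom C A A'" "e' \<cdot> e = Id C A" using isoE[OF assms(1,2)] by metis
  moreover have "(e' \<cdot> e) \<cdot> f = (e' \<cdot> e) \<cdot> g"
    using assms calculation(1) by (simp add: Hom_iff)
  ultimately show ?thesis using assms by (auto simp: Hom_iff simp flip: Comp_assoc_Arr)
qed

end

context finite_coproducts
begin

declare Zero_Obj [simp] Sum_Obj [simp]

lemma Init_Arr [simp]: "A \<in> Obj C \<Longrightarrow> Init Q A \<in> Arr C"
  and Dom_Init [simp]: "A \<in> Obj C \<Longrightarrow> Dom C (Init Q A) = Zero Q"
  and Cod_Init [simp]: "A \<in> Obj C \<Longrightarrow> Cod C (Init Q A) = A"
  using Init_Hom by (auto simp: Hom_iff)

lemma In_Arr [simp]: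
  assumes "A \<in> Obj C" "B \<in> Obj C"
  shows "In0 Q A B \<in> Arr C" "Dom C (In0 Q A B) = A" "Cod C (In0 Q A B) = Sum Q A B"
    "In1 Q A B \<in> Arr C" "Dom C (In1 Q A B) = B" "Cod C (In1 Q A B) = Sum Q A B"
  using In0_Hom[OF assms] In1_Hom[OF assms] by (auto simp: Hom_iff)

lemma Copair_Arr [simp]:
  assumes "f \<in> Arr C" "g \<in> Arr C" "Cod C f = Cod C g"
  shows "Copair Q f g \<in> Arr C" "Dom C (Copair Q f g) = Sum Q (Dom C f) (Dom C g)"
    "Cod C (Copair Q f g) = Cod C g"
  using Copair_Hom[of f "Dom C f" "Cod C g" g "Dom C g"] assms by (auto simp: Hom_iff)

lemma In_Copair [simp]:
  assumes "f \<in> Arr C" "g \<in> Arr C" "Cod C f = Cod C g" "Dom C f = A" "Dom C g = B"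
  shows "In0 Q A B \<cdot> Copair Q f g = f" "In1 Q A B \<cdot> Copair Q f g = g"
  using In0_Copair[of f A "Cod C g" g B] In1_Copair[of f A "Cod C g" g B] assms
  by (auto simp: Hom_iff)

lemma In_Copair_Comp [simp]:
  assumes "f \<in> Arr C" "g \<in> Arr C" "Cod C f = Cod C g" "Dom C f = A" "Dom C g = B"
    "h \<in> Arr C" "Dom C h = Cod C g"
  shows "In0 Q A B \<cdot> (Copair Q f g \<cdot> h) = f \<cdot> h" "In1 Q A B \<cdot> (Copair Q f g \<cdot> h) = g \<cdot> h"
  using assms by (auto simp flip: Comp_assoc_Arr)

lemma Sum_arrow_eqI:
  assumes "h \<in> Hom C (Sum Q A B) D" "h' \<in> Hom C (Sum Q A B) D" "A \<in> Obj C" "B \<in> Obj C"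
    and "In0 Q A B \<cdot> h = In0 Q A B \<cdot> h'" "In1 Q A B \<cdot> h = In1 Q A B \<cdot> h'"
  shows "h = h'"
  using assms Copair_unique[of "In0 Q A B \<cdot> h'" A D "In1 Q A B \<cdot> h'" B h]
    Copair_unique[of "In0 Q A B \<cdot> h'" A D "In1 Q A B \<cdot> h'" B h'] by (simp add: Hom_iff)

lemma Copair_Comp [simp]:
  assumes "f \<in> Arr C" "g \<in> Arr C" "Cod C f = Cod C g" "h \<in> Arr C" "Dom C h = Cod C g"
  shows "Copair Q f g \<cdot> h = Copair Q (f \<cdot> h) (g \<cdot> h)"
  by (rule Sum_arrow_eqI[of _ "Dom C f" "Dom C g" "Cod C h"])
     (use assms in \<open>simp_all add: Hom_iff\<close>)

end

context finite_products
begin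

declare One_Obj [simp] Prod_Obj [simp]

lemma Bang_Arr [simp]:
  assumes "A \<in> Obj C"
  shows "Bang P A \<in> Arr C" "Dom C (Bang P A) = A" "Cod C (Bang P A) = One P"
  using Bang_Hom[OF assms] by (auto simp: Hom_iff)

lemma Comp_Bang [simp]: "f \<in> Arr C \<Longrightarrow> Cod C f = A \<Longrightarrow> f \<cdot> Bang P A = Bang P (Dom C f)"
  by (rule Bang_unique) (auto simp: Hom_iff)

lemma Comp_Bang_Comp [simp]: "f \<in> Arr C \<Longrightarrow> Cod C f = A \<Longrightarrow> h \<in> Arr C \<Longrightarrow> Dom C h = One P \<Longrightarrow>
  f \<cdot> (Bang P A \<cdot> h) = Bang P (Dom C f) \<cdot> h"
  by (subst Comp_Bang[symmetric, of f A]) (auto simp del: Comp_Bang)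

lemma Bang_One [simp]: "Bang P (One P) = Id C (One P)"
  by (rule Bang_unique[symmetric]) (simp add: Hom_iff)

lemma Pr_Arr [simp]:
  assumes "A \<in> Obj C" "B \<in> Obj C"
  shows "Pr0 P A B \<in> Arr C" "Dom C (Pr0 P A B) = Prod P A B" "Cod C (Pr0 P A B) = A"
    "Pr1 P A B \<in> Arr C" "Dom C (Pr1 P A B) = Prod P A B" "Cod C (Pr1 P A B) = B"
  using Pr0_Hom[OF assms] Pr1_Hom[OF assms] by (auto simp: Hom_iff)

lemma Pair_Arr [simp]:
  assumes "f \<in> Arr C" "g \<in> Arr C" "Dom C f = Dom C g"
  shows "Pair P f g \<in> Arr C" "Dom C (Pair P f g) = Dom C g"
    "Cod C (Pair P f g) = Prod P (Cod C f) (Cod C g)"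
  using Pair_Hom[of f "Dom C g" "Cod C f" g "Cod C g"] assms by (auto simp: Hom_iff)

lemma Pair_Pr [simp]:
  assumes "f \<in> Arr C" "g \<in> Arr C" "Dom C f = Dom C g" "Cod C f = A" "Cod C g = B"
  shows "Pair P f g \<cdot> Pr0 P A B = f" "Pair P f g \<cdot> Pr1 P A B = g"
  using Pair_Pr0[of f "Dom C g" A g B] Pair_Pr1[of f "Dom C g" A g B] assms
  by (auto simp: Hom_iff)

lemma Pair_Pr_Comp [simp]:
  assumes "f \<in> Arr C" "g \<in> Arr C" "Dom C f = Dom C g" "Cod C f = A" "Cod C g = B" "h \<in> Arr C"
  shows "Dom C h = A \<Longrightarrow> Pair P f g \<cdot> (Pr0 P A B \<cdot> h) = f \<cdot> h"
    "Dom C h = B \<Longrightarrow> Pair P f g \<cdot> (Pr1 P A B \<cdot> h) = g \<cdot> h"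
  using assms by (auto simp flip: Comp_assoc_Arr)

lemma Comp_Pair:
  assumes "f \<in> Arr C" "g \<in> Arr C" "Dom C f = Dom C g" "h \<in> Arr C" "Cod C h = Dom C g"
  shows "h \<cdot> Pair P f g = Pair P (h \<cdot> f) (h \<cdot> g)"
  by (rule Pair_unique[of _ "Dom C h" "Cod C f" _ "Cod C g"])
     (use assms in \<open>simp_all add: Hom_iff\<close>)

end

section \<open>Restriction categories\<close>

context restriction_category
begin

lemma Rst_Arr [simp]:
  assumes "f \<in> Arr X"
  shows "\<rho> f \<in> Arr X" "Dom X (\<rho> f) = Dom X f" "Cod X (\<rho> f) = Dom X f"
  using Rst_Hom[of f "Dom X f" "Cod X f"] assms by (auto simp: Hom_iff)

lemma total_iff: "f \<in> Hom X A B \<Longrightarrow> total X f \<longleftrightarrow> \<rho> f = Id X A"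
  by (auto simp: total_def Hom_iff)

text \<open>
  If \<open>g\<close> is total, then [R.4] reads \<open>f = \<rho> (f \<cdot> g) \<cdot> f\<close>; taking restrictions with [R.3] gives
  \<open>\<rho> f = \<rho> (f \<cdot> g) \<cdot> \<rho> f\<close>, and \<open>\<rho> f\<close> is an identity.
\<close>

lemma total_Comp:
  assumes f: "f \<in> Hom X A B" and g: "g \<in> Hom X B E" and "total X f" "total X g"
  shows "total X (f \<cdot> g)"
proof -
  have "f = \<rho> (f \<cdot> g) \<cdot> f" using R4[OF f g] assms by (simp add: total_def Hom_iff)
  then have "\<rho> f = \<rho> (f \<cdot> g) \<cdot> \<rho> f"
    using R3[OF f Comp_Hom[OF f g]] by simp
  then show ?thesis using assms by (simp add: total_def Hom_iff)
qed

text \<open>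
  A composite is defined at most where its first factor is: \<open>\<rho> f \<cdot> \<rho> (f \<cdot> g) = \<rho> (f \<cdot> g)\<close>
  by [R.3] and [R.1].
\<close>

lemma total_cancel:
  assumes f: "f \<in> Hom X A B" and g: "g \<in> Hom X B E" and "total X (f \<cdot> g)"
  shows "total X f"
proof -
  have "\<rho> f \<cdot> \<rho> (f \<cdot> g) = \<rho> (\<rho> f \<cdot> (f \<cdot> g))"
    using R3[OF Comp_Hom[OF f g] f] by simp
  also have "\<rho> f \<cdot> (f \<cdot> g) = f \<cdot> g"
    using R1[OF f] f g by (simp add: Hom_iff flip: Comp_assoc_Arr)
  finally show ?thesis using assms by (simp add: total_def Hom_iff)
qed

lemma total_Id [simp]: "A \<in> Obj X \<Longrightarrow> total X (Id X A)"
  using R1[of "Id X A" A A] by (simp add: total_def Hom_iff)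

lemma iso_total:
  assumes "iso X f" shows "total X f"
proof -
  have f: "f \<in> Hom X (Dom X f) (Cod X f)" using assms by (auto simp: iso_def inverse_arrows_def Hom_iff)
  obtain g where "g \<in> Hom X (Cod X f) (Dom X f)" "f \<cdot> g = Id X (Dom X f)"
    using isoE[OF assms f] by metis
  then show ?thesis using total_cancel[OF f, of g] f by (simp add: Hom_iff)
qed

end

text \<open>
  The part of being classically classified that can be stated without restriction products and
  is stable under equivalence: \<open>U\<close> plays the role of the restriction terminal object and
  \<open>S B\<close>, with injections \<open>i B\<close> and \<open>j B\<close>, that of \<open>B \<oplus> 1\<close>. It is enough to know that total
  maps to \<open>U\<close> exist, because their uniqueness follows from classification.
\<close>

locale classifying_coproducts = restriction_category Y
  for Y :: "('o, 'a, 'm) restriction_category_scheme" (structure) +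
  fixes z :: "'o \<Rightarrow> 'o \<Rightarrow> 'a" and U :: 'o and S :: "'o \<Rightarrow> 'o" and i j p :: "'o \<Rightarrow> 'a"
  assumes zeroes: "restriction_zeroes Y z"
    and U_Obj: "U \<in> Obj Y"
    and total_to_U: "A \<in> Obj Y \<Longrightarrow> \<exists>t\<in>Hom Y A U. total Y t"
    and S_Obj: "B \<in> Obj Y \<Longrightarrow> S B \<in> Obj Y"
    and i_Hom: "B \<in> Obj Y \<Longrightarrow> i B \<in> Hom Y B (S B)"
    and j_Hom: "B \<in> Obj Y \<Longrightarrow> j B \<in> Hom Y U (S B)"
    and p_Hom: "B \<in> Obj Y \<Longrightarrow> p B \<in> Hom Y (S B) B"
    and j_total: "B \<in> Obj Y \<Longrightarrow> total Y (j B)"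
    and i_p: "B \<in> Obj Y \<Longrightarrow> i B \<cdot> p B = Id Y B"
    and j_p: "B \<in> Obj Y \<Longrightarrow> j B \<cdot> p B = z U B"
    and copair_exists: "B \<in> Obj Y \<Longrightarrow> f \<in> Hom Y B E \<Longrightarrow> g \<in> Hom Y U E \<Longrightarrow>
          \<exists>h\<in>Hom Y (S B) E. i B \<cdot> h = f \<and> j B \<cdot> h = g"
    and copair_unique: "B \<in> Obj Y \<Longrightarrow> h \<in> Hom Y (S B) E \<Longrightarrow> h' \<in> Hom Y (S B) E \<Longrightarrow>
          i B \<cdot> h = i B \<cdot> h' \<Longrightarrow> j B \<cdot> h = j B \<cdot> h' \<Longrightarrow> h = h'"
    and classifies: "f \<in> Hom Y A B \<Longrightarrow>
          \<exists>!T. T \<in> Hom Y A (S B) \<and> total Y T \<and> T \<cdot> p B = f"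
begin

lemma zero_Hom: "A \<in> Obj Y \<Longrightarrow> B \<in> Obj Y \<Longrightarrow> z A B \<in> Hom Y A B"
  and Rst_zero: "A \<in> Obj Y \<Longrightarrow> B \<in> Obj Y \<Longrightarrow> \<rho> (z A B) = z A A"
  and Comp_zero: "f \<in> Hom Y A B \<Longrightarrow> E \<in> Obj Y \<Longrightarrow> f \<cdot> z B E = z A E"
  and zero_Comp: "f \<in> Hom Y A B \<Longrightarrow> E \<in> Obj Y \<Longrightarrow> z E A \<cdot> f = z E B"
  using zeroes unfolding restriction_zeroes_def by (auto simp: Hom_iff)

text \<open>
  For total \<open>t\<close> and \<open>t'\<close>, both \<open>t \<cdot> j U\<close> and \<open>t' \<cdot> j U\<close> classify the zero map, and \<open>j U\<close> is
  split monic by \<open>[0, 1]\<close>.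
\<close>

lemma total_to_U_unique:
  assumes t: "t \<in> Hom Y A U" "t' \<in> Hom Y A U" and total: "total Y t" "total Y t'"
  shows "t = t'"
proof -
  have A: "A \<in> Obj Y" using t by (auto simp: Hom_iff)
  note j = j_Hom[OF U_Obj]
  have zero: "(s \<cdot> j U) \<cdot> p U = z A U" if "s \<in> Hom Y A U" for s
    using that U_Obj j_Hom[OF U_Obj] p_Hom[OF U_Obj] j_p[OF U_Obj] Comp_zero[of s A U U]
    by (simp add: Hom_iff)
  have "t \<cdot> j U = t' \<cdot> j U"
    using classifies[OF zero_Hom[OF A U_Obj]]
      zero[OF t(1)] Comp_Hom[OF t(1) j] total_Comp[OF t(1) j total(1) j_total[OF U_Obj]]
      zero[OF t(2)] Comp_Hom[OF t(2) j] total_Comp[OF t(2) j total(2) j_total[OF U_Obj]]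
    by blast
  moreover obtain h where h: "h \<in> Hom Y (S U) U" "j U \<cdot> h = Id Y U"
    using copair_exists[OF U_Obj zero_Hom[OF U_Obj U_Obj] Id_Hom[OF U_Obj]] by blast
  ultimately have "t \<cdot> (j U \<cdot> h) = t' \<cdot> (j U \<cdot> h)"
    using Comp_assoc[OF t(1) j h(1)] Comp_assoc[OF t(2) j h(1)] by metis
  then show ?thesis using \<open>j U \<cdot> h = Id Y U\<close> t by (simp add: Hom_iff)
qed

end

section \<open>The Kleisli category of a distributive category\<close>

lemma kleisli_simps [simp]:
  "Obj (kleisli D P Q) = Obj D"
  "(f, B) \<in> Arr (kleisli D P Q) \<longleftrightarrow> B \<in> Obj D \<and> f \<in> Arr D \<and> Cod D f = Sum Q B (One P)"
  "Dom (kleisli D P Q) (f, B) = Dom D f"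
  "Cod (kleisli D P Q) (f, B) = B"
  "Id (kleisli D P Q) A = (In0 Q A (One P), A)"
  "Comp (kleisli D P Q) (f, B) (g, E) = (f \<cdot>\<^bsub>D\<^esub> Copair Q g (In1 Q E (One P)), E)"
  by (simp_all add: kleisli_def)

lemma Hom_kleisli_iff:
  "h \<in> Hom (kleisli D P Q) A B \<longleftrightarrow> B \<in> Obj D \<and> (\<exists>f \<in> Hom D A (Sum Q B (One P)). h = (f, B))"
  by (cases h) (auto simp: Hom_iff)

context distributive_category
begin

text \<open>
  The inverse \<open>A \<times> (B \<oplus> E) \<rightarrow> (A \<times> B) \<oplus> (A \<times> E)\<close> of the distributor.
\<close>

abbreviation undist :: "'o \<Rightarrow> 'o \<Rightarrow> 'o \<Rightarrow> 'a" where
  "undist A B E \<equiv> inv_arrow C (distributor C P Q A B E)"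

lemma distributor_Arr:
  assumes "A \<in> Obj C" "B \<in> Obj C" "E \<in> Obj C"
  shows "distributor C P Q A B E \<in> Hom C (Sum Q (Prod P A B) (Prod P A E)) (Prod P A (Sum Q B E))"
  using assms by (simp add: distributor_def id_times_def Hom_iff)

lemma
  assumes "A \<in> Obj C" "B \<in> Obj C" "E \<in> Obj C"
  shows undist_Arr [simp]: "undist A B E \<in> Arr C"
      "Dom C (undist A B E) = Prod P A (Sum Q B E)"
      "Cod C (undist A B E) = Sum Q (Prod P A B) (Prod P A E)"
    and distributor_undist: "distributor C P Q A B E \<cdot> undist A B E = Id C (Sum Q (Prod P A B) (Prod P A E))"
    and undist_distributor: "undist A B E \<cdot> distributor C P Q A B E = Id C (Prod P A (Sum Q B E))"
  using inverse_arrows_inv_arrow[OF distributor_iso[OF assms]] distributor_Arr[OF assms]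
  by (auto simp: inverse_arrows_def Hom_iff)

text \<open>
  The inverse distributor evaluates case distinctions: a pair whose second component lies in
  one of the summands is sent to the corresponding summand.
\<close>

lemma In_undist:
  assumes "a \<in> Arr C" "b \<in> Arr C" "Dom C a = Dom C b" "Cod C a = A"
    and "B \<in> Obj C" "E \<in> Obj C"
  shows "Cod C b = B \<Longrightarrow> Pair P a (b \<cdot> In0 Q B E) \<cdot> undist A B E = Pair P a b \<cdot> In0 Q (Prod P A B) (Prod P A E)"
      (is "_ \<Longrightarrow> ?G0")
    and "Cod C b = E \<Longrightarrow> Pair P a (b \<cdot> In1 Q B E) \<cdot> undist A B E = Pair P a b \<cdot> In1 Q (Prod P A B) (Prod P A E)"
      (is "_ \<Longrightarrow> ?G1")
proof -
  have "A \<in> Obj C" using assms Cod_Obj by metis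
  note A = assms this
  let ?d = "distributor C P Q A B E"
  have d: "?d \<in> Arr C" "Dom C ?d = Sum Q (Prod P A B) (Prod P A E)" "Cod C ?d = Prod P A (Sum Q B E)"
    using distributor_Arr[of A B E] A by (auto simp: Hom_iff)
  { assume b: "Cod C b = B"
    have "Pair P a (b \<cdot> In0 Q B E) = Pair P a b \<cdot> (In0 Q (Prod P A B) (Prod P A E) \<cdot> ?d)"
      using A b by (simp add: distributor_def id_times_def Comp_Pair)
    then show ?G0 using A b d by (simp add: distributor_undist del: Copair_Comp) }
  { assume b: "Cod C b = E"
    have "Pair P a (b \<cdot> In1 Q B E) = Pair P a b \<cdot> (In1 Q (Prod P A B) (Prod P A E) \<cdot> ?d)"
      using A b by (simp add: distributor_def id_times_def Comp_Pair)
    then show ?G1 using A b d by (simp add: distributor_undist del: Copair_Comp) }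
qed

lemma In_undist_Comp:
  assumes "a \<in> Arr C" "b \<in> Arr C" "Dom C a = Dom C b" "Cod C a = A"
    and "B \<in> Obj C" "E \<in> Obj C"
    and "v \<in> Hom C (Sum Q (Prod P A B) (Prod P A E)) Z"
  shows "Cod C b = B \<Longrightarrow>
      Pair P a (b \<cdot> In0 Q B E) \<cdot> (undist A B E \<cdot> v) = Pair P a b \<cdot> (In0 Q (Prod P A B) (Prod P A E) \<cdot> v)"
      (is "_ \<Longrightarrow> ?G0")
    and "Cod C b = E \<Longrightarrow>
      Pair P a (b \<cdot> In1 Q B E) \<cdot> (undist A B E \<cdot> v) = Pair P a b \<cdot> (In1 Q (Prod P A B) (Prod P A E) \<cdot> v)"
      (is "_ \<Longrightarrow> ?G1")
proof -
  have "A \<in> Obj C" using assms Cod_Obj by metis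
  note A = assms this
  { assume b: "Cod C b = B"
    have "Pair P a (b \<cdot> In0 Q B E) \<cdot> (undist A B E \<cdot> v) = (Pair P a (b \<cdot> In0 Q B E) \<cdot> undist A B E) \<cdot> v"
      using A b by (simp add: Hom_iff)
    then show ?G0 using A b by (simp add: In_undist Hom_iff) }
  { assume b: "Cod C b = E"
    have "Pair P a (b \<cdot> In1 Q B E) \<cdot> (undist A B E \<cdot> v) = (Pair P a (b \<cdot> In1 Q B E) \<cdot> undist A B E) \<cdot> v"
      using A b by (simp add: Hom_iff)
    then show ?G1 using A b by (simp add: In_undist Hom_iff) }
qed

lemma undist_Pr1:
  assumes "A \<in> Obj C" "B \<in> Obj C" "E \<in> Obj C"
  shows "undist A B E \<cdot> Copair Q (Pr1 P A B \<cdot> In0 Q B E) (Pr1 P A E \<cdot> In1 Q B E) = Pr1 P A (Sum Q B E)"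
proof -
  let ?d = "distributor C P Q A B E"
  have d: "?d \<in> Arr C" "Dom C ?d = Sum Q (Prod P A B) (Prod P A E)" "Cod C ?d = Prod P A (Sum Q B E)"
    using distributor_Arr[of A B E] assms by (auto simp: Hom_iff)
  have "Copair Q (Pr1 P A B \<cdot> In0 Q B E) (Pr1 P A E \<cdot> In1 Q B E) = ?d \<cdot> Pr1 P A (Sum Q B E)"
    using assms by (simp add: distributor_def id_times_def)
  then have "undist A B E \<cdot> Copair Q (Pr1 P A B \<cdot> In0 Q B E) (Pr1 P A E \<cdot> In1 Q B E)
      = (undist A B E \<cdot> ?d) \<cdot> Pr1 P A (Sum Q B E)"
    using assms d by simp
  then show ?thesis using assms by (simp add: undist_distributor)
qed

abbreviation Kl :: "('o, 'a \<times> 'o) restriction_category" where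
  "Kl \<equiv> kleisli C P Q"

lemma Rst_kleisli:
  assumes "f \<in> Hom C A (Sum Q B (One P))" "B \<in> Obj C"
  shows "Rst Kl (f, B) =
    (Pair P (Id C A) f \<cdot> (undist A B (One P) \<cdot>
       Copair Q (Pr0 P A B \<cdot> In0 Q A (One P)) (Pr1 P A (One P) \<cdot> In1 Q A (One P))), A)"
  using assms unfolding kleisli_def by (auto simp: sum_arrow_def Hom_iff Let_def simp del: Copair_Comp)

lemma Rst_kleisli_Hom:
  assumes f: "f \<in> Hom C A (Sum Q B (One P))" and B: "B \<in> Obj C"
  shows "Rst Kl (f, B) \<in> Hom Kl A A"
proof -
  have "A \<in> Obj C" using f by (auto simp: Hom_iff)
  then show ?thesis using assms unfolding Rst_kleisli[OF assms] by (simp add: Hom_iff)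
qed

text \<open>
  The maps of the base category are total Kleisli maps; the converse is false in general.
\<close>

lemma Rst_kleisli_defined:
  assumes "h \<in> Hom C A B"
  shows "Rst Kl (h \<cdot> In0 Q B (One P), B) = Id Kl A"
proof -
  have [simp]: "h \<in> Arr C" "Dom C h = A" "Cod C h = B" "A \<in> Obj C" "B \<in> Obj C"
    using assms Dom_Obj Cod_Obj by (auto simp: Hom_iff)
  show ?thesis
    by (subst Rst_kleisli[of _ A], simp add: Hom_iff, simp, subst In_undist_Comp(1))
       (simp_all add: Hom_iff)
qed

lemma Rst_kleisli_undefined:
  assumes "A \<in> Obj C" "B \<in> Obj C"
  shows "Rst Kl (Bang P A \<cdot> In1 Q B (One P), B) = (Bang P A \<cdot> In1 Q A (One P), A)"
proof -
  note [simp] = assms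
  show ?thesis
    by (subst Rst_kleisli[of _ A], simp add: Hom_iff, simp, subst In_undist_Comp(2))
       (simp_all add: Hom_iff)
qed

text \<open>
  Let \<open>s : A \<rightarrow> A \<oplus> 1\<close> be the restriction of \<open>T\<close>. Both \<open>T\<close> and \<open>s\<close> are images of the single
  map \<open>k : A \<rightarrow> (A \<times> E) \<oplus> (A \<times> 1)\<close> obtained from the graph of \<open>T\<close>, so at each point either both
  are defined or both are undefined. The map \<open>e : (E \<oplus> 1) \<times> (A \<oplus> 1) \<rightarrow> E \<oplus> 1\<close> distinguishes
  cases on its second argument: it sends \<open>(x, \<iota>\<^sub>0 a)\<close> to \<open>[1, c] x\<close>, which is always defined,
  and \<open>(x, \<iota>\<^sub>1 *)\<close> to the undefined element. On the pairs that come from \<open>k\<close> it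
  returns the first component, hence \<open>\<langle>T, s\<rangle> e = T\<close>. If \<open>T\<close> is total then \<open>s = \<iota>\<^sub>0\<close>, only the
  first case applies, and \<open>\<langle>T, s\<rangle> e = T [1, c] \<iota>\<^sub>0\<close>.
\<close>

lemma total_kleisli_factors:
  assumes T: "T \<in> Hom C A (Sum Q E (One P))" and c: "c \<in> Hom C (One P) E"
    and total: "Rst Kl (T, E) = Id Kl A"
  shows "T = T \<cdot> (Copair Q (Id C E) c \<cdot> In0 Q E (One P))"
proof -
  have [simp]: "T \<in> Arr C" "Dom C T = A" "Cod C T = Sum Q E (One P)" "c \<in> Arr C" "Dom C c = One P"
    "Cod C c = E" "A \<in> Obj C" "E \<in> Obj C"
    using T c Dom_Obj Cod_Obj by (auto simp: Hom_iff)
  (* T = k a and s = k b, while e = undist v *)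
  let ?M = "Sum Q E (One P)"
  let ?k = "Pair P (Id C A) T \<cdot> undist A E (One P)"
  let ?a = "Copair Q (Pr1 P A E \<cdot> In0 Q E (One P)) (Pr1 P A (One P) \<cdot> In1 Q E (One P))"
  let ?b = "Copair Q (Pr0 P A E \<cdot> In0 Q A (One P)) (Pr1 P A (One P) \<cdot> In1 Q A (One P))"
  let ?u = "Copair Q (Id C E) c \<cdot> In0 Q E (One P)"
  let ?v = "Copair Q (Pr0 P ?M A \<cdot> ?u) (Pr1 P ?M (One P) \<cdot> In1 Q E (One P))"
  let ?e = "undist ?M A (One P) \<cdot> ?v"
  have s: "?k \<cdot> ?b = In0 Q A (One P)"
    using total by (subst (asm) Rst_kleisli[of _ A]) (simp_all add: Hom_iff del: Copair_Comp)
  have T_eq: "?k \<cdot> ?a = T"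
    by (simp add: undist_Pr1 del: Copair_Comp)
  have e0: "Pair P x (y \<cdot> In0 Q A (One P)) \<cdot> ?e = x \<cdot> ?u"
    if "x \<in> Hom C Z ?M" "y \<in> Hom C Z A" for x y Z
    using that by (subst In_undist_Comp(1)) (simp_all add: Hom_iff del: Copair_Comp)
  have e1: "Pair P x (y \<cdot> In1 Q A (One P)) \<cdot> ?e = y \<cdot> In1 Q E (One P)"
    if "x \<in> Hom C Z ?M" "y \<in> Hom C Z (One P)" for x y Z
    using that by (subst In_undist_Comp(2)) (simp_all add: Hom_iff del: Copair_Comp)
  have "Pair P ?a ?b \<cdot> ?e = ?a"
  proof (rule Sum_arrow_eqI[of _ "Prod P A E" "Prod P A (One P)" ?M])
    have "In0 Q (Prod P A E) (Prod P A (One P)) \<cdot> (Pair P ?a ?b \<cdot> ?e)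
        = Pair P (Pr1 P A E \<cdot> In0 Q E (One P)) (Pr0 P A E \<cdot> In0 Q A (One P)) \<cdot> ?e"
      by (subst Comp_assoc_Arr[symmetric]) (simp_all add: Comp_Pair del: Copair_Comp)
    then show "In0 Q (Prod P A E) (Prod P A (One P)) \<cdot> (Pair P ?a ?b \<cdot> ?e)
        = In0 Q (Prod P A E) (Prod P A (One P)) \<cdot> ?a"
      by (subst (asm) e0[of _ "Prod P A E"]) (simp_all add: Hom_iff)
    have "In1 Q (Prod P A E) (Prod P A (One P)) \<cdot> (Pair P ?a ?b \<cdot> ?e)
        = Pair P (Pr1 P A (One P) \<cdot> In1 Q E (One P)) (Pr1 P A (One P) \<cdot> In1 Q A (One P)) \<cdot> ?e"
      by (subst Comp_assoc_Arr[symmetric]) (simp_all add: Comp_Pair del: Copair_Comp)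
    then show "In1 Q (Prod P A E) (Prod P A (One P)) \<cdot> (Pair P ?a ?b \<cdot> ?e)
        = In1 Q (Prod P A E) (Prod P A (One P)) \<cdot> ?a"
      by (subst (asm) e1[of _ "Prod P A (One P)"]) (simp_all add: Hom_iff)
  qed (simp_all add: Hom_iff)
  then have "?k \<cdot> (Pair P ?a ?b \<cdot> ?e) = T" by (simp add: T_eq del: Copair_Comp Comp_assoc_Arr)
  moreover have "?k \<cdot> (Pair P ?a ?b \<cdot> ?e) = Pair P (?k \<cdot> ?a) (?k \<cdot> ?b) \<cdot> ?e"
    by (subst Comp_Pair[symmetric]) (simp_all del: Copair_Comp)
  moreover have "Pair P (?k \<cdot> ?a) (?k \<cdot> ?b) \<cdot> ?e = T \<cdot> ?u"
    unfolding s T_eq using e0[of T A "Id C A"] by (simp add: Hom_iff del: Copair_Comp)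
  ultimately show ?thesis by simp
qed

text \<open>
  The zero map is the everywhere undefined one, and the coproduct \<open>B \<oplus> 1\<close> of the base category
  is also a coproduct of \<open>B\<close> and \<open>1\<close> in the Kleisli category. Its retraction onto \<open>B\<close> is given by
  the identity of \<open>B \<oplus> 1\<close>: an element of \<open>B\<close> is kept and the exception is turned into
  undefinedness. So \<open>f : A \<rightarrow> B \<oplus> 1\<close> is classified by \<open>f\<close> itself read as a total map, that
  is by \<open>f \<iota>\<^sub>0\<close>, and any other classifying map agrees with it because \<open>B \<oplus> 1\<close> has the
  point \<open>\<iota>\<^sub>1\<close>.
\<close>

lemma kleisli_classifying_coproducts:
  assumes "restriction_category Kl"
  shows "classifying_coproducts Kl (\<lambda>A B. (Bang P A \<cdot> In1 Q B (One P), B)) (One P)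
    (\<lambda>B. Sum Q B (One P))
    (\<lambda>B. (In0 Q B (One P) \<cdot> In0 Q (Sum Q B (One P)) (One P), Sum Q B (One P)))
    (\<lambda>B. (In1 Q B (One P) \<cdot> In0 Q (Sum Q B (One P)) (One P), Sum Q B (One P)))
    (\<lambda>B. (Id C (Sum Q B (One P)), B))"
proof -
  interpret Kl: restriction_category Kl by fact
  let ?z = "\<lambda>A B. (Bang P A \<cdot> In1 Q B (One P), B)"
  let ?S = "\<lambda>B. Sum Q B (One P)"
  let ?i = "\<lambda>B. (In0 Q B (One P) \<cdot> In0 Q (?S B) (One P), ?S B)"
  let ?j = "\<lambda>B. (In1 Q B (One P) \<cdot> In0 Q (?S B) (One P), ?S B)"
  let ?p = "\<lambda>B. (Id C (?S B), B)"
  have Bang_In1: "Copair Q (Bang P A \<cdot> In1 Q B (One P)) (In1 Q B (One P)) = Bang P (?S A) \<cdot> In1 Q B (One P)"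
    if "A \<in> Obj C" "B \<in> Obj C" for A B
    by (rule Sum_arrow_eqI[of _ A "One P"]) (use that in \<open>simp_all add: Hom_iff\<close>)
  show ?thesis
  proof
    show "restriction_zeroes Kl ?z"
      by (auto simp: restriction_zeroes_def Hom_kleisli_iff Rst_kleisli_undefined Bang_In1 Hom_iff)
    show "One P \<in> Obj Kl" by simp
    show "\<exists>t\<in>Hom Kl A (One P). Defs.total Kl t" if "A \<in> Obj Kl" for A
      using that Rst_kleisli_defined[of "Bang P A" A "One P"]
      by (intro bexI[of _ "(Bang P A \<cdot> In0 Q (One P) (One P), One P)"])
        (auto simp: total_def Hom_iff)
    fix B assume "B \<in> Obj Kl"
    then have [simp]: "B \<in> Obj C" by simp
    show "?S B \<in> Obj Kl" "?i B \<in> Hom Kl B (?S B)" "?j B \<in> Hom Kl (One P) (?S B)" "?p B \<in> Hom Kl (?S B) B"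
      by (auto simp: Hom_iff)
    show "Defs.total Kl (?j B)"
      using Rst_kleisli_defined[of "In1 Q B (One P)" "One P" "?S B"] by (simp add: total_def Hom_iff)
    show "Comp Kl (?i B) (?p B) = Id Kl B" "Comp Kl (?j B) (?p B) = ?z (One P) B"
      by simp_all
  next
    fix f g B E assume "B \<in> Obj Kl" "f \<in> Hom Kl B E" "g \<in> Hom Kl (One P) E"
    then obtain f' g' where "f' \<in> Hom C B (?S E)" "f = (f', E)" "g' \<in> Hom C (One P) (?S E)" "g = (g', E)"
        "B \<in> Obj C" "E \<in> Obj C"
      by (auto simp: Hom_kleisli_iff)
    then show "\<exists>h\<in>Hom Kl (?S B) E. Comp Kl (?i B) h = f \<and> Comp Kl (?j B) h = g"
      by (intro bexI[of _ "(Copair Q f' g', E)"]) (simp_all add: Hom_iff)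
  next
    fix h h' B E assume "B \<in> Obj Kl" and h: "h \<in> Hom Kl (?S B) E" "h' \<in> Hom Kl (?S B) E"
      and "Comp Kl (?i B) h = Comp Kl (?i B) h'" "Comp Kl (?j B) h = Comp Kl (?j B) h'"
    then obtain k k' where "k \<in> Hom C (?S B) (?S E)" "h = (k, E)" "k' \<in> Hom C (?S B) (?S E)" "h' = (k', E)"
        "B \<in> Obj C" "E \<in> Obj C" "Comp Kl (?i B) (k, E) = Comp Kl (?i B) (k', E)"
        "Comp Kl (?j B) (k, E) = Comp Kl (?j B) (k', E)"
      unfolding Hom_kleisli_iff by auto
    then show "h = h'"
      using Sum_arrow_eqI[of k B "One P" "?S E" k'] by (simp add: Hom_iff)
  next
    fix f A B assume "f \<in> Hom Kl A B"
    then obtain f' where f': "f' \<in> Hom C A (?S B)" "f = (f', B)" and [simp]: "B \<in> Obj C"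
      by (auto simp: Hom_kleisli_iff)
    show "\<exists>!T. T \<in> Hom Kl A (?S B) \<and> Defs.total Kl T \<and> Comp Kl T (?p B) = f"
    proof (rule ex1I[of _ "(f' \<cdot> In0 Q (?S B) (One P), ?S B)"])
      show "(f' \<cdot> In0 Q (?S B) (One P), ?S B) \<in> Hom Kl A (?S B) \<and>
          Defs.total Kl (f' \<cdot> In0 Q (?S B) (One P), ?S B) \<and>
          Comp Kl (f' \<cdot> In0 Q (?S B) (One P), ?S B) (?p B) = f"
        using f' Rst_kleisli_defined[OF f'(1)] by (auto simp: Hom_iff total_def)
    next
      fix T assume T: "T \<in> Hom Kl A (?S B) \<and> Defs.total Kl T \<and> Comp Kl T (?p B) = f"
      then obtain T' where T': "T' \<in> Hom C A (Sum Q (?S B) (One P))" "T = (T', ?S B)"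
        by (auto simp: Hom_kleisli_iff)
      have "T' = T' \<cdot> (Copair Q (Id C (?S B)) (In1 Q B (One P)) \<cdot> In0 Q (?S B) (One P))"
        by (rule total_kleisli_factors[OF T'(1)])
          (use T T' in \<open>auto simp: total_def Hom_iff\<close>)
      moreover have "T' \<cdot> Copair Q (Id C (?S B)) (In1 Q B (One P)) = f'"
        using T T' f' by simp
      ultimately show "T = (f' \<cdot> In0 Q (?S B) (One P), ?S B)"
        using T' by (auto simp: Hom_iff simp del: Copair_Comp simp flip: Comp_assoc_Arr)
    qed
  qed
qed

end

section \<open>Transport along restriction equivalences\<close>

locale restriction_weak_equivalence = restriction_functor X Y Fo Fa
  for X :: "('o, 'a, 'm) restriction_category_scheme"
    and Y :: "('p, 'b, 'n) restriction_category_scheme"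
    and Fo :: "'o \<Rightarrow> 'p" and Fa :: "'a \<Rightarrow> 'b" +
  assumes faithful: "f \<in> Hom X A B \<Longrightarrow> g \<in> Hom X A B \<Longrightarrow> Fa f = Fa g \<Longrightarrow> f = g"
    and full: "A \<in> Obj X \<Longrightarrow> B \<in> Obj X \<Longrightarrow> h \<in> Hom Y (Fo A) (Fo B) \<Longrightarrow> \<exists>f\<in>Hom X A B. Fa f = h"
    and essentially_surjective: "C \<in> Obj Y \<Longrightarrow> \<exists>A\<in>Obj X. \<exists>e\<in>Hom Y (Fo A) C. iso Y e"
begin

text \<open>
  Totality is an equation between the parallel maps \<open>\<rho> f\<close> and \<open>1\<close>, so a faithful functor
  that preserves restriction also reflects totality.
\<close>

lemma Fa_total_iff:
  assumes f: "f \<in> Hom X A B"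
  shows "total Y (Fa f) \<longleftrightarrow> total X f"
proof -
  have A: "A \<in> Obj X" using f by (auto simp: Hom_iff)
  have "total Y (Fa f) \<longleftrightarrow> Fa (Rst X f) = Fa (Id X A)"
    using target.total_iff[OF Fa_Hom[OF f]] Fa_Rst[of f] Fa_Id[OF A] f by (simp add: Hom_iff)
  also have "\<dots> \<longleftrightarrow> Rst X f = Id X A"
    using faithful[OF source.Rst_Hom[OF f] source.Id_Hom[OF A]] by metis
  finally show ?thesis using source.total_iff[OF f] by simp
qed

end

lemma restriction_equivalent_weak_equivalence:
  assumes "restriction_equivalent X Y"
  shows "\<exists>Fo Fa. restriction_weak_equivalence X Y Fo Fa"
proof -
  obtain Fo Fa Go Ga \<eta> \<epsilon> where
    F: "restriction_functor X Y Fo Fa" and G: "restriction_functor Y X Go Ga" and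
    \<eta>: "natural_iso X X id id (Go \<circ> Fo) (Ga \<circ> Fa) \<eta>" and
    \<epsilon>: "natural_iso Y Y (Fo \<circ> Go) (Fa \<circ> Ga) id id \<epsilon>"
    using assms unfolding restriction_equivalent_def by blast
  interpret F: restriction_functor X Y Fo Fa by fact
  interpret G: restriction_functor Y X Go Ga by fact
  have \<eta>_Hom: "\<eta> A \<in> Hom X A (Go (Fo A))" "iso X (\<eta> A)" if "A \<in> Obj X" for A
    using \<eta> that by (auto simp: natural_iso_def)
  have \<eta>_nat: "f \<cdot>\<^bsub>X\<^esub> \<eta> B = \<eta> A \<cdot>\<^bsub>X\<^esub> Ga (Fa f)" if "f \<in> Hom X A B" for f A B
    using \<eta> that F.source.Dom_Obj F.source.Cod_Obj by (auto simp: natural_iso_def Hom_iff)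
  have \<epsilon>_Hom: "\<epsilon> A \<in> Hom Y (Fo (Go A)) A" "iso Y (\<epsilon> A)" if "A \<in> Obj Y" for A
    using \<epsilon> that by (auto simp: natural_iso_def)
  have \<epsilon>_nat: "Fa (Ga f) \<cdot>\<^bsub>Y\<^esub> \<epsilon> B = \<epsilon> A \<cdot>\<^bsub>Y\<^esub> f" if "f \<in> Hom Y A B" for f A B
    using \<epsilon> that F.target.Dom_Obj F.target.Cod_Obj by (auto simp: natural_iso_def Hom_iff)
  have Obj: "A \<in> Obj X" "B \<in> Obj X" if "f \<in> Hom X A B" for f A B
    using that by (auto simp: Hom_iff)
  have F_faithful: "f = g" if "f \<in> Hom X A B" "g \<in> Hom X A B" "Fa f = Fa g" for f g A B
    using F.source.iso_cancel_right[OF \<eta>_Hom(2,1), of B f A g] \<eta>_nat[of f A B] \<eta>_nat[of g A B] Obj that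
    by simp
  have G_faithful: "f = g" if "f \<in> Hom Y A B" "g \<in> Hom Y A B" "Ga f = Ga g" for f g A B
  proof -
    have "A \<in> Obj Y" using that by (auto simp: Hom_iff)
    then show ?thesis
      using F.target.iso_cancel_left[OF \<epsilon>_Hom(2,1), of A f B g] \<epsilon>_nat[of f A B] \<epsilon>_nat[of g A B] that
      by simp
  qed
  have "restriction_weak_equivalence X Y Fo Fa"
  proof
    show "f = g" if "f \<in> Hom X A B" "g \<in> Hom X A B" "Fa f = Fa g" for f g A B
      using F_faithful that by blast
    show "\<exists>A\<in>Obj X. \<exists>e\<in>Hom Y (Fo A) B. Defs.iso Y e" if "B \<in> Obj Y" for B
      using \<epsilon>_Hom[OF that] G.Fo_Obj[OF that] by blast
    fix A B h assume A: "A \<in> Obj X" and B: "B \<in> Obj X" and h: "h \<in> Hom Y (Fo A) (Fo B)"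
    obtain e where e: "e \<in> Hom X (Go (Fo B)) B" "e \<cdot>\<^bsub>X\<^esub> \<eta> B = Id X (Go (Fo B))"
      using F.source.isoE[OF \<eta>_Hom(2)[OF B] \<eta>_Hom(1)[OF B]] by metis
    (* By naturality of the unit this is the only candidate for a preimage of h. *)
    define f where "f = \<eta> A \<cdot>\<^bsub>X\<^esub> (Ga h \<cdot>\<^bsub>X\<^esub> e)"
    note Gh = G.Fa_Hom[OF h]
    have f: "f \<in> Hom X A B"
      using \<eta>_Hom(1)[OF A] Gh e(1) by (simp add: f_def Hom_iff)
    have "f \<cdot>\<^bsub>X\<^esub> \<eta> B = \<eta> A \<cdot>\<^bsub>X\<^esub> Ga h"
      using \<eta>_Hom(1)[OF A] \<eta>_Hom(1)[OF B] Gh e by (simp add: f_def Hom_iff)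
    then have "\<eta> A \<cdot>\<^bsub>X\<^esub> Ga (Fa f) = \<eta> A \<cdot>\<^bsub>X\<^esub> Ga h"
      using \<eta>_nat[OF f] by simp
    then have "Ga (Fa f) = Ga h"
      using F.source.iso_cancel_left[OF \<eta>_Hom(2)[OF A] \<eta>_Hom(1)[OF A] G.Fa_Hom[OF F.Fa_Hom[OF f]] Gh] by simp
    then have "Fa f = h" using G_faithful[OF F.Fa_Hom[OF f] h] by simp
    then show "\<exists>f\<in>Hom X A B. Fa f = h" using f by blast
  qed
  then show ?thesis by blast
qed

locale classification_transport =
  X: distributive_restriction_category X P Q +
  Y: classifying_coproducts Y z U S i j p +
  restriction_weak_equivalence X Y Fo Fa
  for X :: "('o, 'a, 'm) restriction_category_scheme"
    and Y :: "('p, 'b, 'n) restriction_category_scheme"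
    and Fo :: "'o \<Rightarrow> 'p" and Fa :: "'a \<Rightarrow> 'b"
    and P :: "('o, 'a) products" and Q :: "('o, 'a) coproducts"
    and z :: "'p \<Rightarrow> 'p \<Rightarrow> 'b" and U :: 'p and S :: "'p \<Rightarrow> 'p" and i j p :: "'p \<Rightarrow> 'b"
begin

declare X.One_Obj [simp]

text \<open>
  The zero maps of \<open>X\<close> are the preimages of those of \<open>Y\<close>, which are unique by faithfulness.
\<close>

definition zero :: "'o \<Rightarrow> 'o \<Rightarrow> 'a" where
  "zero A B = (SOME f. f \<in> Hom X A B \<and> Fa f = z (Fo A) (Fo B))"

lemma zero:
  assumes "A \<in> Obj X" "B \<in> Obj X"
  shows zero_Hom: "zero A B \<in> Hom X A B" and Fa_zero: "Fa (zero A B) = z (Fo A) (Fo B)"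
  using someI_ex[of "\<lambda>f. f \<in> Hom X A B \<and> Fa f = z (Fo A) (Fo B)"]
    full[OF assms Y.zero_Hom[OF Fo_Obj Fo_Obj]] assms
  unfolding zero_def by blast+

lemma restriction_zeroes: "restriction_zeroes X zero"
  unfolding restriction_zeroes_def
proof (intro conjI ballI)
  fix A B assume A: "A \<in> Obj X" and B: "B \<in> Obj X"
  show zAB: "zero A B \<in> Hom X A B" using zero_Hom[OF A B] .
  show "Rst X (zero A B) = zero A A"
    using faithful[OF X.Rst_Hom[OF zAB] zero_Hom[OF A A]] Fa_Rst[of "zero A B"] zAB
      Fa_zero[OF A B] Fa_zero[OF A A] Y.Rst_zero[OF Fo_Obj[OF A] Fo_Obj[OF B]]
    by (simp add: Hom_iff)
  fix E f assume E: "E \<in> Obj X" and f: "f \<in> Hom X A B"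
  show "f \<cdot>\<^bsub>X\<^esub> zero B E = zero A E"
    using faithful[OF X.Comp_Hom[OF f zero_Hom[OF B E]] zero_Hom[OF A E]]
      Fa_Comp[OF f zero_Hom[OF B E]] Fa_zero[OF B E] Fa_zero[OF A E]
      Y.Comp_zero[OF Fa_Hom[OF f] Fo_Obj[OF E]] by simp
  show "zero E A \<cdot>\<^bsub>X\<^esub> f = zero E B"
    using faithful[OF X.Comp_Hom[OF zero_Hom[OF E A] f] zero_Hom[OF E B]]
      Fa_Comp[OF zero_Hom[OF E A] f] Fa_zero[OF E A] Fa_zero[OF E B]
      Y.zero_Comp[OF Fa_Hom[OF f] Fo_Obj[OF E]] by simp
qed

text \<open>
  The image of the restriction terminal object is isomorphic to \<open>U\<close>: total maps exist in both
  directions, and the composites are total endomaps of objects that have only one total endomap.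
\<close>

lemma unit_comparison:
  obtains s t where "s \<in> Hom Y (Fo (One P)) U" "t \<in> Hom Y U (Fo (One P))"
    "s \<cdot>\<^bsub>Y\<^esub> t = Id Y (Fo (One P))" "t \<cdot>\<^bsub>Y\<^esub> s = Id Y U"
proof -
  obtain s where s: "s \<in> Hom Y (Fo (One P)) U" "total Y s"
    using Y.total_to_U[OF Fo_Obj[OF X.One_Obj]] by blast
  obtain G e where G: "G \<in> Obj X" and e: "e \<in> Hom Y (Fo G) U" "iso Y e"
    using essentially_surjective[OF Y.U_Obj] by blast
  obtain e' where e': "e' \<in> Hom Y U (Fo G)" "iso Y e'"
    using Y.isoE[OF e(2,1)] by metis
  have b: "Fa (Bang P G) \<in> Hom Y (Fo G) (Fo (One P))" "total Y (Fa (Bang P G))"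
    using Fa_Hom[OF X.Bang_Hom[OF G]] Fa_total_iff[OF X.Bang_Hom[OF G]] X.Bang_total[OF G] by auto
  (* Since U need not be in the image of the functor, the total map to 1 is taken at G. *)
  define t where "t = e' \<cdot>\<^bsub>Y\<^esub> Fa (Bang P G)"
  have t: "t \<in> Hom Y U (Fo (One P))" "total Y t"
    unfolding t_def using Y.Comp_Hom[OF e'(1) b(1)] Y.total_Comp[OF e'(1) b(1) Y.iso_total[OF e'(2)] b(2)]
    by auto
  have "t \<cdot>\<^bsub>Y\<^esub> s = Id Y U"
    using Y.total_to_U_unique[OF Y.Comp_Hom[OF t(1) s(1)] Y.Id_Hom[OF Y.U_Obj]]
      Y.total_Comp[OF t(1) s(1)] t s Y.U_Obj by simp
  moreover have "s \<cdot>\<^bsub>Y\<^esub> t = Id Y (Fo (One P))"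
  proof -
    obtain w where w: "w \<in> Hom X (One P) (One P)" "Fa w = s \<cdot>\<^bsub>Y\<^esub> t"
      using full[OF X.One_Obj X.One_Obj Y.Comp_Hom[OF s(1) t(1)]] by blast
    have "total X w"
      using Fa_total_iff[OF w(1)] w(2) Y.total_Comp[OF s(1) t(1)] s t by simp
    then have "w = Id X (One P)"
      using X.Bang_unique[OF w(1)] X.Bang_unique[OF X.Id_Hom[OF X.One_Obj]] by simp
    then show ?thesis using w(2) Fa_Id[OF X.One_Obj] by simp
  qed
  ultimately show thesis using that s t by blast
qed

abbreviation retraction :: "'o \<Rightarrow> 'a" where
  "retraction B \<equiv> Copair Q (Id X B) (zero (One P) B)"

lemma retraction_Hom: "B \<in> Obj X \<Longrightarrow> retraction B \<in> Hom X (Sum Q B (One P)) B"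
  using X.Copair_Hom[OF X.Id_Hom zero_Hom] by simp

text \<open>
  A fully faithful, essentially surjective functor preserves coproducts, here only up to the
  comparison between \<open>Fo (One P)\<close> and \<open>U\<close>. The map \<open>\<psi>\<close> comes from the universal property of
  \<open>S (Fo B)\<close>. The map \<open>\<phi>\<close> is a copairing in \<open>X\<close>, which only has targets in \<open>X\<close>, so \<open>S (Fo B)\<close>
  is first replaced by an isomorphic object in the image of the functor. The universal properties
  on both sides show that \<open>\<phi>\<close> and \<open>\<psi>\<close> are mutually inverse and compatible with
  the retractions onto \<open>B\<close>.
\<close>

lemma sum_comparison:
  assumes B: "B \<in> Obj X"
  obtains \<phi> \<psi> where "\<phi> \<in> Hom Y (Fo (Sum Q B (One P))) (S (Fo B))"
    "\<psi> \<in> Hom Y (S (Fo B)) (Fo (Sum Q B (One P)))"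
    "\<phi> \<cdot>\<^bsub>Y\<^esub> \<psi> = Id Y (Fo (Sum Q B (One P)))" "\<psi> \<cdot>\<^bsub>Y\<^esub> \<phi> = Id Y (S (Fo B))"
    "\<psi> \<cdot>\<^bsub>Y\<^esub> Fa (retraction B) = p (Fo B)"
proof -
  let ?S = "Sum Q B (One P)" and ?B = "Fo B" and ?One = "Fo (One P)"
  let ?in0 = "In0 Q B (One P)" and ?in1 = "In1 Q B (One P)"
  have S: "?S \<in> Obj X" and FB: "?B \<in> Obj Y" and SFB: "S ?B \<in> Obj Y"
    using B Fo_Obj Y.S_Obj by auto
  note in0 = X.In0_Hom[OF B X.One_Obj] and in1 = X.In1_Hom[OF B X.One_Obj]
  note Fin0 = Fa_Hom[OF in0] and Fin1 = Fa_Hom[OF in1]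
  note i = Y.i_Hom[OF FB] and j = Y.j_Hom[OF FB]
  obtain s t where s: "s \<in> Hom Y ?One U" and t: "t \<in> Hom Y U ?One"
    and st: "s \<cdot>\<^bsub>Y\<^esub> t = Id Y ?One" and ts: "t \<cdot>\<^bsub>Y\<^esub> s = Id Y U"
    by (rule unit_comparison)
  obtain \<psi> where \<psi>: "\<psi> \<in> Hom Y (S ?B) (Fo ?S)"
    and i\<psi>: "i ?B \<cdot>\<^bsub>Y\<^esub> \<psi> = Fa ?in0" and j\<psi>: "j ?B \<cdot>\<^bsub>Y\<^esub> \<psi> = t \<cdot>\<^bsub>Y\<^esub> Fa ?in1"
    using Y.copair_exists[OF FB Fin0 Y.Comp_Hom[OF t Fin1]] by blast
  obtain G e where G: "G \<in> Obj X" and e: "e \<in> Hom Y (Fo G) (S ?B)" "iso Y e"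
    using essentially_surjective[OF SFB] by blast
  obtain e' where e': "e' \<in> Hom Y (S ?B) (Fo G)" "e' \<cdot>\<^bsub>Y\<^esub> e = Id Y (S ?B)"
    using Y.isoE[OF e(2,1)] by metis
  obtain u where u: "u \<in> Hom X B G" "Fa u = i ?B \<cdot>\<^bsub>Y\<^esub> e'"
    using full[OF B G Y.Comp_Hom[OF i e'(1)]] by blast
  obtain v where v: "v \<in> Hom X (One P) G" "Fa v = s \<cdot>\<^bsub>Y\<^esub> (j ?B \<cdot>\<^bsub>Y\<^esub> e')"
    using full[OF X.One_Obj G Y.Comp_Hom[OF s Y.Comp_Hom[OF j e'(1)]]] by blast
  let ?w = "Copair Q u v"
  note w = X.Copair_Hom[OF u(1) v(1)]
  define \<phi> where "\<phi> = Fa ?w \<cdot>\<^bsub>Y\<^esub> e"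
  have \<phi>: "\<phi> \<in> Hom Y (Fo ?S) (S ?B)"
    unfolding \<phi>_def using Y.Comp_Hom[OF Fa_Hom[OF w] e(1)] .
  have "Fa ?in0 \<cdot>\<^bsub>Y\<^esub> \<phi> = (Fa ?in0 \<cdot>\<^bsub>Y\<^esub> Fa ?w) \<cdot>\<^bsub>Y\<^esub> e"
    unfolding \<phi>_def using Y.Comp_assoc[OF Fin0 Fa_Hom[OF w] e(1)] by simp
  also have "\<dots> = (i ?B \<cdot>\<^bsub>Y\<^esub> e') \<cdot>\<^bsub>Y\<^esub> e"
    using Fa_Comp[OF in0 w] X.In0_Copair[OF u(1) v(1)] u(2) by simp
  also have "\<dots> = i ?B"
    using i e' e(1) by (simp add: Hom_iff)
  finally have in0\<phi>: "Fa ?in0 \<cdot>\<^bsub>Y\<^esub> \<phi> = i ?B" .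
  have "Fa ?in1 \<cdot>\<^bsub>Y\<^esub> \<phi> = (Fa ?in1 \<cdot>\<^bsub>Y\<^esub> Fa ?w) \<cdot>\<^bsub>Y\<^esub> e"
    unfolding \<phi>_def using Y.Comp_assoc[OF Fin1 Fa_Hom[OF w] e(1)] by simp
  also have "\<dots> = (s \<cdot>\<^bsub>Y\<^esub> (j ?B \<cdot>\<^bsub>Y\<^esub> e')) \<cdot>\<^bsub>Y\<^esub> e"
    using Fa_Comp[OF in1 w] X.In1_Copair[OF u(1) v(1)] v(2) by simp
  also have "\<dots> = s \<cdot>\<^bsub>Y\<^esub> j ?B"
    using s j e' e(1) by (simp add: Hom_iff)
  finally have in1\<phi>: "Fa ?in1 \<cdot>\<^bsub>Y\<^esub> \<phi> = s \<cdot>\<^bsub>Y\<^esub> j ?B" .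
  have "\<psi> \<cdot>\<^bsub>Y\<^esub> \<phi> = Id Y (S ?B)"
  proof (rule Y.copair_unique[OF FB Y.Comp_Hom[OF \<psi> \<phi>] Y.Id_Hom[OF SFB]])
    show "i ?B \<cdot>\<^bsub>Y\<^esub> (\<psi> \<cdot>\<^bsub>Y\<^esub> \<phi>) = i ?B \<cdot>\<^bsub>Y\<^esub> Id Y (S ?B)"
      using Y.Comp_assoc[OF i \<psi> \<phi>] Y.Id_right[OF i] by (simp add: i\<psi> in0\<phi>)
    have "j ?B \<cdot>\<^bsub>Y\<^esub> (\<psi> \<cdot>\<^bsub>Y\<^esub> \<phi>) = t \<cdot>\<^bsub>Y\<^esub> (s \<cdot>\<^bsub>Y\<^esub> j ?B)"
      using Y.Comp_assoc[OF j \<psi> \<phi>] Y.Comp_assoc[OF t Fin1 \<phi>] by (simp add: j\<psi> in1\<phi>)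
    also have "\<dots> = j ?B"
      using Y.Comp_assoc[OF t s j] Y.Id_left[OF j] by (simp add: ts)
    finally show "j ?B \<cdot>\<^bsub>Y\<^esub> (\<psi> \<cdot>\<^bsub>Y\<^esub> \<phi>) = j ?B \<cdot>\<^bsub>Y\<^esub> Id Y (S ?B)"
      using Y.Id_right[OF j] by simp
  qed
  moreover have "\<phi> \<cdot>\<^bsub>Y\<^esub> \<psi> = Id Y (Fo ?S)"
  proof -
    obtain x where x: "x \<in> Hom X ?S ?S" "Fa x = \<phi> \<cdot>\<^bsub>Y\<^esub> \<psi>"
      using full[OF S S Y.Comp_Hom[OF \<phi> \<psi>]] by blast
    have "Fa (?in0 \<cdot>\<^bsub>X\<^esub> x) = Fa ?in0"
      using Fa_Comp[OF in0 x(1)] Y.Comp_assoc[OF Fin0 \<phi> \<psi>] by (simp add: x(2) in0\<phi> i\<psi>)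
    then have x0: "?in0 \<cdot>\<^bsub>X\<^esub> x = ?in0" using faithful[OF X.Comp_Hom[OF in0 x(1)] in0] by simp
    have "Fa (?in1 \<cdot>\<^bsub>X\<^esub> x) = (s \<cdot>\<^bsub>Y\<^esub> j ?B) \<cdot>\<^bsub>Y\<^esub> \<psi>"
      using Fa_Comp[OF in1 x(1)] Y.Comp_assoc[OF Fin1 \<phi> \<psi>] by (simp add: x(2) in1\<phi>)
    also have "\<dots> = s \<cdot>\<^bsub>Y\<^esub> (t \<cdot>\<^bsub>Y\<^esub> Fa ?in1)"
      using Y.Comp_assoc[OF s j \<psi>] by (simp add: j\<psi>)
    also have "\<dots> = Fa ?in1"
      using Y.Comp_assoc[OF s t Fin1] Y.Id_left[OF Fin1] by (simp add: st)
    finally have x1: "?in1 \<cdot>\<^bsub>X\<^esub> x = ?in1" using faithful[OF X.Comp_Hom[OF in1 x(1)] in1] by simp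
    have "x = Id X ?S"
      using X.Sum_arrow_eqI[OF x(1) X.Id_Hom[OF S] B X.One_Obj] x0 x1
        X.Id_right[OF in0] X.Id_right[OF in1] by simp
    then show ?thesis using x(2) Fa_Id[OF S] by simp
  qed
  moreover have "\<psi> \<cdot>\<^bsub>Y\<^esub> Fa (retraction B) = p ?B"
  proof -
    note r = retraction_Hom[OF B] and p = Y.p_Hom[OF FB]
    note Fr = Fa_Hom[OF r]
    show ?thesis
    proof (rule Y.copair_unique[OF FB Y.Comp_Hom[OF \<psi> Fr] p])
      have "i ?B \<cdot>\<^bsub>Y\<^esub> (\<psi> \<cdot>\<^bsub>Y\<^esub> Fa (retraction B)) = Fa (?in0 \<cdot>\<^bsub>X\<^esub> retraction B)"
        using Y.Comp_assoc[OF i \<psi> Fr] Fa_Comp[OF in0 r] by (simp add: i\<psi>)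
      also have "\<dots> = Id Y ?B"
        using X.In0_Copair[OF X.Id_Hom[OF B] zero_Hom[OF X.One_Obj B]] Fa_Id[OF B] by simp
      finally show "i ?B \<cdot>\<^bsub>Y\<^esub> (\<psi> \<cdot>\<^bsub>Y\<^esub> Fa (retraction B)) = i ?B \<cdot>\<^bsub>Y\<^esub> p ?B"
        using Y.i_p[OF FB] by simp
      have "j ?B \<cdot>\<^bsub>Y\<^esub> (\<psi> \<cdot>\<^bsub>Y\<^esub> Fa (retraction B)) = t \<cdot>\<^bsub>Y\<^esub> Fa (?in1 \<cdot>\<^bsub>X\<^esub> retraction B)"
        using Y.Comp_assoc[OF j \<psi> Fr] Y.Comp_assoc[OF t Fin1 Fr] Fa_Comp[OF in1 r] by (simp add: j\<psi>)
      also have "\<dots> = z U ?B"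
        using X.In1_Copair[OF X.Id_Hom[OF B] zero_Hom[OF X.One_Obj B]] Fa_zero[OF X.One_Obj B]
          Y.Comp_zero[OF t FB] by simp
      finally show "j ?B \<cdot>\<^bsub>Y\<^esub> (\<psi> \<cdot>\<^bsub>Y\<^esub> Fa (retraction B)) = j ?B \<cdot>\<^bsub>Y\<^esub> p ?B"
        using Y.j_p[OF FB] by simp
    qed
  qed
  ultimately show thesis using that \<phi> \<psi> by blast
qed

text \<open>
  Total maps \<open>A \<rightarrow> B \<oplus> 1\<close> of \<open>X\<close> correspond to total maps \<open>Fo A \<rightarrow> S (Fo B)\<close> of \<open>Y\<close> by applying
  the functor and composing with \<open>\<phi>\<close>; this turns the retraction of \<open>X\<close> into that of \<open>Y\<close>.
\<close>

lemma unique_classifying_map: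
  assumes A: "A \<in> Obj X" and B: "B \<in> Obj X" and f: "f \<in> Hom X A B"
  shows "\<exists>!T. T \<in> Hom X A (Sum Q B (One P)) \<and> total X T \<and> T \<cdot>\<^bsub>X\<^esub> retraction B = f"
proof -
  let ?S = "Sum Q B (One P)"
  have S: "?S \<in> Obj X" using B by simp
  note r = retraction_Hom[OF B] and p = Y.p_Hom[OF Fo_Obj[OF B]]
  note Fr = Fa_Hom[OF r]
  obtain \<phi> \<psi> where \<phi>: "\<phi> \<in> Hom Y (Fo ?S) (S (Fo B))" and \<psi>: "\<psi> \<in> Hom Y (S (Fo B)) (Fo ?S)"
    and \<phi>\<psi>: "\<phi> \<cdot>\<^bsub>Y\<^esub> \<psi> = Id Y (Fo ?S)" and \<psi>\<phi>: "\<psi> \<cdot>\<^bsub>Y\<^esub> \<phi> = Id Y (S (Fo B))"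
    and \<psi>r: "\<psi> \<cdot>\<^bsub>Y\<^esub> Fa (retraction B) = p (Fo B)"
    by (rule sum_comparison[OF B])
  have total: "total Y \<phi>" "total Y \<psi>"
    using Y.isoI[OF \<phi> \<psi> \<phi>\<psi> \<psi>\<phi>] Y.iso_total by auto
  have "\<phi> \<cdot>\<^bsub>Y\<^esub> p (Fo B) = (\<phi> \<cdot>\<^bsub>Y\<^esub> \<psi>) \<cdot>\<^bsub>Y\<^esub> Fa (retraction B)"
    using Y.Comp_assoc[OF \<phi> \<psi> Fr] by (simp add: \<psi>r)
  then have \<phi>p: "\<phi> \<cdot>\<^bsub>Y\<^esub> p (Fo B) = Fa (retraction B)"
    using \<phi>\<psi> Y.Id_left[OF Fr] by simp
  obtain T' where T': "T' \<in> Hom Y (Fo A) (S (Fo B))" "total Y T'" "T' \<cdot>\<^bsub>Y\<^esub> p (Fo B) = Fa f"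
    and T'_unique: "\<And>T''. T'' \<in> Hom Y (Fo A) (S (Fo B)) \<Longrightarrow> total Y T'' \<Longrightarrow>
       T'' \<cdot>\<^bsub>Y\<^esub> p (Fo B) = Fa f \<Longrightarrow> T'' = T'"
    using Y.classifies[OF Fa_Hom[OF f]] by blast
  obtain T where T: "T \<in> Hom X A ?S" "Fa T = T' \<cdot>\<^bsub>Y\<^esub> \<psi>"
    using full[OF A S Y.Comp_Hom[OF T'(1) \<psi>]] by blast
  show ?thesis
  proof (rule ex1I[of _ T])
    have "total X T"
      using Fa_total_iff[OF T(1)] T(2) Y.total_Comp[OF T'(1) \<psi> T'(2) total(2)] by simp
    moreover have "Fa (T \<cdot>\<^bsub>X\<^esub> retraction B) = Fa f"
      using Fa_Comp[OF T(1) r] Y.Comp_assoc[OF T'(1) \<psi> Fr] by (simp add: T(2) \<psi>r T'(3))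
    then have "T \<cdot>\<^bsub>X\<^esub> retraction B = f" using faithful[OF X.Comp_Hom[OF T(1) r] f] by simp
    ultimately show "T \<in> Hom X A ?S \<and> total X T \<and> T \<cdot>\<^bsub>X\<^esub> retraction B = f" using T(1) by simp
  next
    fix V assume "V \<in> Hom X A ?S \<and> total X V \<and> V \<cdot>\<^bsub>X\<^esub> retraction B = f"
    then have V: "V \<in> Hom X A ?S" "total X V" "V \<cdot>\<^bsub>X\<^esub> retraction B = f" by auto
    note FV = Fa_Hom[OF V(1)]
    have "Fa V \<cdot>\<^bsub>Y\<^esub> \<phi> = T'"
      using T'_unique[OF Y.Comp_Hom[OF FV \<phi>]] Y.total_Comp[OF FV \<phi> _ total(1)] Fa_total_iff[OF V(1)] V(2)
        Y.Comp_assoc[OF FV \<phi> p] Fa_Comp[OF V(1) r] by (simp add: \<phi>p V(3))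
    then have "Fa V = Fa T"
      using Y.Comp_assoc[OF FV \<phi> \<psi>] Y.Id_right[OF FV] by (simp add: T(2) \<phi>\<psi>)
    then show "V = T" using faithful[OF V(1) T(1)] by simp
  qed
qed

lemma classically_classified: "classically_classified X P Q"
  unfolding classically_classified_def using restriction_zeroes unique_classifying_map by blast

end

section \<open>The total maps of a classically classified category\<close>

text \<open>
  All axioms of a restriction category, apart from typing, are equations between parallel maps.
  They can therefore be pulled back along anything that preserves the operations and is
  injective on hom-sets. For Kleisli categories this replaces direct calculations with the
  restriction formula.
\<close>

lemma reflect_restriction_functor:
  fixes K :: "('p, 'b, 'n) restriction_category_scheme" and X :: "('o, 'a, 'm) restriction_category_scheme"
  assumes X: "restriction_category X"
    and K: "\<And>f. f \<in> Arr K \<Longrightarrow> Dom K f \<in> Obj K" "\<And>f. f \<in> Arr K \<Longrightarrow> Cod K f \<in> Obj K"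
      "\<And>A. A \<in> Obj K \<Longrightarrow> Id K A \<in> Hom K A A"
      "\<And>f g A B E. f \<in> Hom K A B \<Longrightarrow> g \<in> Hom K B E \<Longrightarrow> f \<cdot>\<^bsub>K\<^esub> g \<in> Hom K A E"
      "\<And>f A B. f \<in> Hom K A B \<Longrightarrow> Rst K f \<in> Hom K A A"
    and Go: "\<And>A. A \<in> Obj K \<Longrightarrow> Go A \<in> Obj X"
    and Ga: "\<And>f A B. f \<in> Hom K A B \<Longrightarrow> Ga f \<in> Hom X (Go A) (Go B)"
      "\<And>A. A \<in> Obj K \<Longrightarrow> Ga (Id K A) = Id X (Go A)"
      "\<And>f g A B E. f \<in> Hom K A B \<Longrightarrow> g \<in> Hom K B E \<Longrightarrow> Ga (f \<cdot>\<^bsub>K\<^esub> g) = Ga f \<cdot>\<^bsub>X\<^esub> Ga g"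
      "\<And>f A B. f \<in> Hom K A B \<Longrightarrow> Ga (Rst K f) = Rst X (Ga f)"
    and faithful: "\<And>f g A B. f \<in> Hom K A B \<Longrightarrow> g \<in> Hom K A B \<Longrightarrow> Ga f = Ga g \<Longrightarrow> f = g"
  shows "restriction_functor K X Go Ga"
proof -
  interpret X: restriction_category X by fact
  have Obj: "A \<in> Obj K" "B \<in> Obj K" if "f \<in> Hom K A B" for f A B
    using that K(1,2) by (auto simp: Hom_iff)
  have "restriction_category K"
  proof
    show "(f \<cdot>\<^bsub>K\<^esub> g) \<cdot>\<^bsub>K\<^esub> h = f \<cdot>\<^bsub>K\<^esub> (g \<cdot>\<^bsub>K\<^esub> h)"
      if f: "f \<in> Hom K A B" and g: "g \<in> Hom K B E" and h: "h \<in> Hom K E E'" for f g h A B E E'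
      by (rule faithful[OF K(4)[OF K(4)[OF f g] h] K(4)[OF f K(4)[OF g h]]])
        (simp add: Ga(3)[OF K(4)[OF f g] h] Ga(3)[OF f K(4)[OF g h]] Ga(3)[OF f g] Ga(3)[OF g h]
          X.Comp_assoc[OF Ga(1)[OF f] Ga(1)[OF g] Ga(1)[OF h]])
    show "Id K A \<cdot>\<^bsub>K\<^esub> f = f" if f: "f \<in> Hom K A B" for f A B
      by (rule faithful[OF K(4)[OF K(3)[OF Obj(1)[OF f]] f] f])
        (simp add: Ga(3)[OF K(3)[OF Obj(1)[OF f]] f] Ga(2)[OF Obj(1)[OF f]] X.Id_left[OF Ga(1)[OF f]])
    show "f \<cdot>\<^bsub>K\<^esub> Id K B = f" if f: "f \<in> Hom K A B" for f A B
      by (rule faithful[OF K(4)[OF f K(3)[OF Obj(2)[OF f]]] f])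
        (simp add: Ga(3)[OF f K(3)[OF Obj(2)[OF f]]] Ga(2)[OF Obj(2)[OF f]] X.Id_right[OF Ga(1)[OF f]])
    show "Rst K f \<cdot>\<^bsub>K\<^esub> f = f" if f: "f \<in> Hom K A B" for f A B
      by (rule faithful[OF K(4)[OF K(5)[OF f] f] f])
        (simp add: Ga(3)[OF K(5)[OF f] f] Ga(4)[OF f] X.R1[OF Ga(1)[OF f]])
    show "Rst K f \<cdot>\<^bsub>K\<^esub> Rst K g = Rst K g \<cdot>\<^bsub>K\<^esub> Rst K f"
      if f: "f \<in> Hom K A B" and g: "g \<in> Hom K A E" for f g A B E
      by (rule faithful[OF K(4)[OF K(5)[OF f] K(5)[OF g]] K(4)[OF K(5)[OF g] K(5)[OF f]]])
        (simp add: Ga(3)[OF K(5)[OF f] K(5)[OF g]] Ga(3)[OF K(5)[OF g] K(5)[OF f]] Ga(4)[OF f] Ga(4)[OF g]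
          X.R2[OF Ga(1)[OF f] Ga(1)[OF g]])
    show "Rst K (Rst K g \<cdot>\<^bsub>K\<^esub> f) = Rst K g \<cdot>\<^bsub>K\<^esub> Rst K f"
      if f: "f \<in> Hom K A B" and g: "g \<in> Hom K A E" for f g A B E
      by (rule faithful[OF K(5)[OF K(4)[OF K(5)[OF g] f]] K(4)[OF K(5)[OF g] K(5)[OF f]]])
        (simp add: Ga(4)[OF K(4)[OF K(5)[OF g] f]] Ga(3)[OF K(5)[OF g] f] Ga(3)[OF K(5)[OF g] K(5)[OF f]]
          Ga(4)[OF f] Ga(4)[OF g] X.R3[OF Ga(1)[OF f] Ga(1)[OF g]])
    show "f \<cdot>\<^bsub>K\<^esub> Rst K g = Rst K (f \<cdot>\<^bsub>K\<^esub> g) \<cdot>\<^bsub>K\<^esub> f"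
      if f: "f \<in> Hom K A B" and g: "g \<in> Hom K B E" for f g A B E
      by (rule faithful[OF K(4)[OF f K(5)[OF g]] K(4)[OF K(5)[OF K(4)[OF f g]] f]])
        (simp add: Ga(3)[OF f K(5)[OF g]] Ga(4)[OF g] Ga(3)[OF K(5)[OF K(4)[OF f g]] f]
          Ga(4)[OF K(4)[OF f g]] Ga(3)[OF f g] X.R4[OF Ga(1)[OF f] Ga(1)[OF g]])
  qed (use K in blast)+
  then interpret K: restriction_category K .
  show ?thesis
    by unfold_locales (use Go Ga in \<open>auto simp: Hom_iff\<close>)
qed

definition total_subcategory :: "('o, 'a, 'm) restriction_category_scheme \<Rightarrow> ('o, 'a) category" where
  "total_subcategory X =
     \<lparr> Obj = Obj X, Arr = {f \<in> Arr X. total X f}, Dom = Dom X, Cod = Cod X, Id = Id X, Comp = Comp X \<rparr>"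

lemma total_subcategory_simps [simp]:
  "Obj (total_subcategory X) = Obj X"
  "Dom (total_subcategory X) = Dom X"
  "Cod (total_subcategory X) = Cod X"
  "Id (total_subcategory X) = Id X"
  "Comp (total_subcategory X) = Comp X"
  by (simp_all add: total_subcategory_def)

lemma Hom_total_subcategory_iff:
  "f \<in> Hom (total_subcategory X) A B \<longleftrightarrow> f \<in> Hom X A B \<and> total X f"
  by (auto simp: Hom_def total_subcategory_def)

lemma distributor_total_subcategory:
  "distributor (total_subcategory X) P Q = distributor X P Q"
  "nullary_distributor (total_subcategory X) P Q = nullary_distributor X P Q"
  by (auto simp: distributor_def nullary_distributor_def id_times_def fun_eq_iff)

lemma (in restriction_category) inverse_arrows_total_subcategory:
  assumes "inverse_arrows X f g"
  shows "inverse_arrows (total_subcategory X) f g"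
  using assms iso_total[of f] iso_total[of g] inverse_arrows_sym[OF assms]
  by (auto simp: inverse_arrows_def iso_def total_subcategory_def Hom_def)

context cocartesian_restriction_category
begin

text \<open>
  The restriction of a map out of the initial object is the only endomap of that object.
\<close>

lemma Init_total:
  assumes "A \<in> Obj X" shows "total X (Init Q A)"
  using Init_unique[OF Rst_Hom[OF Init_Hom[OF assms]]] Init_unique[OF Id_Hom[OF Zero_Obj]] assms
  by (simp add: total_def)

lemma Copair_total:
  assumes f: "f \<in> Hom X A E" and g: "g \<in> Hom X B E" and total: "total X f" "total X g"
  shows "total X (Copair Q f g)"
proof -
  have AB: "A \<in> Obj X" "B \<in> Obj X" using f g by (auto simp: Hom_iff)
  note h = Copair_Hom[OF f g]
  have "\<rho> (Copair Q f g) = Id X (Sum Q A B)"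
  proof (rule Sum_arrow_eqI[OF Rst_Hom[OF h] Id_Hom AB])
    show "In0 Q A B \<cdot> \<rho> (Copair Q f g) = In0 Q A B \<cdot> Id X (Sum Q A B)"
      using R4[OF In0_Hom[OF AB] h] In0_Copair[OF f g] total f AB by (simp add: total_iff Hom_iff)
    show "In1 Q A B \<cdot> \<rho> (Copair Q f g) = In1 Q A B \<cdot> Id X (Sum Q A B)"
      using R4[OF In1_Hom[OF AB] h] In1_Copair[OF f g] total g AB by (simp add: total_iff Hom_iff)
  qed (use AB in simp)
  then show ?thesis using total_iff[OF h] by simp
qed

end

context cartesian_restriction_category
begin

lemma Pair_Pr_total:
  assumes f: "f \<in> Hom X E A" and g: "g \<in> Hom X E B"
  shows "total X g \<Longrightarrow> Pair P f g \<cdot> Pr0 P A B = f" "total X f \<Longrightarrow> Pair P f g \<cdot> Pr1 P A B = g"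
  using Pair_Pr0[OF f g] Pair_Pr1[OF f g] Id_left[OF f] Id_left[OF g] total_iff[OF f] total_iff[OF g]
  by simp_all

lemma Pair_total:
  assumes f: "f \<in> Hom X E A" and g: "g \<in> Hom X E B" and "total X f" "total X g"
  shows "total X (Pair P f g)"
proof -
  have "A \<in> Obj X" "B \<in> Obj X" using f g by (auto simp: Hom_iff)
  then show ?thesis
    using total_cancel[OF Pair_Hom[OF f g] Pr0_Hom] Pair_Pr_total[OF f g] assms by simp
qed

end

context distributive_restriction_category
begin

text \<open>
  The canonical maps are the same in both categories, and their inverses are total because
  isomorphisms are.
\<close>

lemma distributive_total_subcategory: "distributive_category (total_subcategory X) P Q"
proof -
  have iso: "iso (total_subcategory X) f" if "iso X f" for f
    using that inverse_arrows_total_subcategory unfolding iso_def by blast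
  show ?thesis
  proof (unfold_locales, goal_cases)
    case (1 f) then show ?case by (simp add: total_subcategory_def)
  next
    case (2 f) then show ?case by (simp add: total_subcategory_def)
  next
    case 3 then show ?case by (simp add: Hom_total_subcategory_iff Id_Hom)
  next
    case 4 then show ?case using Comp_Hom total_Comp by (auto simp: Hom_total_subcategory_iff)
  next
    case (5 f A B) then show ?case using Id_left[of f A B] by (simp add: Hom_total_subcategory_iff)
  next
    case (6 f A B) then show ?case using Id_right[of f A B] by (simp add: Hom_total_subcategory_iff)
  next
    case (7 f A B g D h E)
    then show ?case using Comp_assoc[of f A B g D h E] by (simp add: Hom_total_subcategory_iff)
  qed (use One_Obj Bang_Hom Bang_total Bang_unique Prod_Obj Pr0_Hom Pr1_Hom Pr0_total Pr1_total
      Pair_Hom Pair_total Pair_Pr_total Pair_unique Pair_Pr0 Pair_Pr1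
      Zero_Obj Init_Hom Init_total Init_unique Sum_Obj In0_Hom In1_Hom In0_total In1_total
      Copair_Hom Copair_total In0_Copair In1_Copair Copair_unique
      iso distributor_iso nullary_distributor_iso in
      \<open>auto simp: Hom_total_subcategory_iff distributor_total_subcategory\<close>)
qed

end

lemma restriction_equivalent_of_bijective_functor:
  fixes X :: "('o, 'a, 'm) restriction_category_scheme" and K :: "('o, 'b, 'n) restriction_category_scheme"
  assumes G: "restriction_functor K X id Ga" and Obj: "Obj K = Obj X"
    and faithful: "\<And>f g A B. f \<in> Hom K A B \<Longrightarrow> g \<in> Hom K A B \<Longrightarrow> Ga f = Ga g \<Longrightarrow> f = g"
    and full: "\<And>f A B. f \<in> Hom X A B \<Longrightarrow> \<exists>g\<in>Hom K A B. Ga g = f"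
  shows "restriction_equivalent X K"
proof -
  interpret G: restriction_functor K X id Ga by fact
  define Fa where "Fa f = (SOME g. g \<in> Hom K (Dom X f) (Cod X f) \<and> Ga g = f)" for f
  have Fa: "Fa f \<in> Hom K A B" "Ga (Fa f) = f" if "f \<in> Hom X A B" for f A B
  proof -
    have AB: "Dom X f = A" "Cod X f = B" using that by (auto simp: Hom_iff)
    have "\<exists>g. g \<in> Hom K A B \<and> Ga g = f" using full[OF that] by blast
    from someI_ex[OF this] show "Fa f \<in> Hom K A B" "Ga (Fa f) = f" by (simp_all add: Fa_def AB)
  qed
  have Ga: "Ga f \<in> Hom X A B" if "f \<in> Hom K A B" for f A B
    using G.Fa_Hom[OF that] by simp
  have FG: "Fa (Ga g) = g" if "g \<in> Hom K A B" for g A B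
    using faithful[OF Fa(1)[OF Ga[OF that]] that] Fa(2)[OF Ga[OF that]] by simp
  have "restriction_functor X K id Fa"
  proof
    show "id A \<in> Obj K" if "A \<in> Obj X" for A using that Obj by simp
    show "Fa f \<in> Hom K (id A) (id B)" if "f \<in> Hom X A B" for f A B using Fa(1)[OF that] by simp
    show "Fa (Id X A) = Id K (id A)" if A: "A \<in> Obj X" for A
      using FG[OF G.source.Id_Hom[of A]] G.Fa_Id[of A] A Obj by simp
    show "Fa (f \<cdot>\<^bsub>X\<^esub> g) = Fa f \<cdot>\<^bsub>K\<^esub> Fa g" if f: "f \<in> Hom X A B" and g: "g \<in> Hom X B E" for f g A B E
      using FG[OF G.source.Comp_Hom[OF Fa(1)[OF f] Fa(1)[OF g]]] G.Fa_Comp[OF Fa(1)[OF f] Fa(1)[OF g]]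
        Fa(2)[OF f] Fa(2)[OF g] by simp
    show "Fa (Rst X f) = Rst K (Fa f)" if "f \<in> Arr X" for f
    proof -
      have f: "f \<in> Hom X (Dom X f) (Cod X f)" using that by (simp add: Hom_iff)
      then show ?thesis
        using FG[OF G.source.Rst_Hom[OF Fa(1)[OF f]]] G.Fa_Rst[of "Fa f"] Fa[OF f] by (simp add: Hom_iff)
    qed
  qed
  moreover have "natural_iso X X id id (id \<circ> id) (Ga \<circ> Fa) (Id X)"
    unfolding natural_iso_def
  proof (intro conjI ballI)
    fix A assume A: "A \<in> Obj X"
    note Id = G.target.Id_Hom[OF A]
    show "Id X A \<in> Hom X (id A) ((id \<circ> id) A)" using Id by simp
    show "iso X (Id X A)" using G.target.isoI(1)[OF Id Id] G.target.Id_left[OF Id] by simp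
    fix B f assume "f \<in> Hom X A B"
    then show "id f \<cdot>\<^bsub>X\<^esub> Id X B = Id X A \<cdot>\<^bsub>X\<^esub> (Ga \<circ> Fa) f"
      using G.target.Id_left G.target.Id_right Fa(2) by simp
  qed
  moreover have "natural_iso K K (id \<circ> id) (Fa \<circ> Ga) id id (Id K)"
    unfolding natural_iso_def
  proof (intro conjI ballI)
    fix A assume A: "A \<in> Obj K"
    note Id = G.source.Id_Hom[OF A]
    show "Id K A \<in> Hom K ((id \<circ> id) A) (id A)" using Id by simp
    show "iso K (Id K A)" using G.source.isoI(1)[OF Id Id] G.source.Id_left[OF Id] by simp
    fix B f assume "f \<in> Hom K A B"
    then show "(Fa \<circ> Ga) f \<cdot>\<^bsub>K\<^esub> Id K B = Id K A \<cdot>\<^bsub>K\<^esub> id f"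
      using G.source.Id_left G.source.Id_right FG by simp
  qed
  ultimately show ?thesis
    using G G.source.total_Id G.target.total_Id unfolding restriction_equivalent_def by blast
qed

text \<open>
  If \<open>\<rho> g \<cdot> k\<close> is thought of as \<open>k\<close> restricted to the domain of \<open>g\<close>, then precomposition with
  \<open>h\<close> pulls this domain back along \<open>h\<close>.
\<close>

lemma (in restriction_category) Comp_Rst_Comp:
  assumes h: "h \<in> Hom X A B" and g: "g \<in> Hom X B E" and k: "k \<in> Hom X B F"
  shows "h \<cdot> (\<rho> g \<cdot> k) = \<rho> (h \<cdot> g) \<cdot> (h \<cdot> k)"
  using R4[OF h g] Comp_assoc[OF h Rst_Hom[OF g] k]
    Comp_assoc[OF Rst_Hom[OF Comp_Hom[OF h g]] h k] by simp

locale classified_restriction_category = distributive_restriction_category X P Q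
  for X :: "('o, 'a, 'm) restriction_category_scheme" (structure)
    and P :: "('o, 'a) products" and Q :: "('o, 'a) coproducts" +
  fixes z :: "'o \<Rightarrow> 'o \<Rightarrow> 'a"
  assumes zeroes: "restriction_zeroes X z"
    and classifies: "f \<in> Hom X A B \<Longrightarrow> \<exists>!T. T \<in> Hom X A (Sum Q B (One P)) \<and> total X T \<and>
          T \<cdot> Copair Q (Id X B) (z (One P) B) = f"
begin

declare One_Obj [simp] Prod_Obj [simp]

lemma zero_Arr [simp]:
  assumes "A \<in> Obj X" "B \<in> Obj X"
  shows "z A B \<in> Arr X" "Dom X (z A B) = A" "Cod X (z A B) = B" "\<rho> (z A B) = z A A"
proof -
  have "z A B \<in> Hom X A B" "\<rho> (z A B) = z A A"
    using zeroes assms unfolding restriction_zeroes_def by blast+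
  then show "z A B \<in> Arr X" "Dom X (z A B) = A" "Cod X (z A B) = B" "\<rho> (z A B) = z A A"
    by (simp_all add: Hom_iff)
qed

lemma Comp_zero [simp]:
  assumes "f \<in> Arr X" "Cod X f = B" "E \<in> Obj X"
  shows "f \<cdot> z B E = z (Dom X f) E"
proof -
  have "f \<in> Hom X (Dom X f) B" "Dom X f \<in> Obj X" "B \<in> Obj X" using assms by (auto simp: Hom_iff)
  then show ?thesis using zeroes assms(3) unfolding restriction_zeroes_def by blast
qed

lemma zero_Comp [simp]:
  assumes "f \<in> Arr X" "Dom X f = A" "E \<in> Obj X"
  shows "z E A \<cdot> f = z E (Cod X f)"
proof -
  have "f \<in> Hom X A (Cod X f)" "Cod X f \<in> Obj X" "A \<in> Obj X" using assms by (auto simp: Hom_iff)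
  then show ?thesis using zeroes assms(3) unfolding restriction_zeroes_def by blast
qed

lemma Pr_Arr [simp]:
  assumes "A \<in> Obj X" "B \<in> Obj X"
  shows "Pr0 P A B \<in> Arr X" "Dom X (Pr0 P A B) = Prod P A B" "Cod X (Pr0 P A B) = A"
    "Pr1 P A B \<in> Arr X" "Dom X (Pr1 P A B) = Prod P A B" "Cod X (Pr1 P A B) = B"
  using Pr0_Hom[OF assms] Pr1_Hom[OF assms] by (auto simp: Hom_iff)

abbreviation retraction :: "'o \<Rightarrow> 'a" where
  "retraction B \<equiv> Copair Q (Id X B) (z (One P) B)"

lemma retraction_Hom: "B \<in> Obj X \<Longrightarrow> retraction B \<in> Hom X (Sum Q B (One P)) B"
  by (simp add: Hom_iff)

text \<open>
  On the summand \<open>A \<times> B\<close> the distributor followed by \<open>\<pi>\<^sub>1 [1, 0]\<close> is the total map \<open>\<pi>\<^sub>1\<close>, and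
  on \<open>A \<times> 1\<close> it is zero. So restricting \<open>\<pi>\<^sub>0\<close> to the domain of \<open>\<pi>\<^sub>1 [1, 0]\<close> keeps it
  on the first summand and annihilates it on the second.
\<close>

lemma distributor_Rst_retraction:
  assumes A: "A \<in> Obj X" and B: "B \<in> Obj X"
  shows "distributor X P Q A B (One P) \<cdot>
      (\<rho> (Pr1 P A (Sum Q B (One P)) \<cdot> retraction B) \<cdot> Pr0 P A (Sum Q B (One P)))
    = Copair Q (Pr0 P A B) (z (Prod P A (One P)) A)"
proof -
  note [simp] = A B
  let ?S = "Sum Q B (One P)"
  let ?n0 = "id_times X P A (In0 Q B (One P))" and ?n1 = "id_times X P A (In1 Q B (One P))"
  let ?w = "\<rho> (Pr1 P A ?S \<cdot> retraction B) \<cdot> Pr0 P A ?S"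
  have S: "?S \<in> Obj X" by simp
  note pr0 = Pr0_Hom[OF A B] and pr1 = Pr1_Hom[OF A B]
  note pr0' = Pr0_Hom[OF A One_Obj] and pr1' = Pr1_Hom[OF A One_Obj]
  note in0 = In0_Hom[OF B One_Obj] and in1 = In1_Hom[OF B One_Obj]
  have total0: "total X (Pr1 P A B \<cdot> In0 Q B (One P))"
    using total_Comp[OF pr1 in0] Pr1_total In0_total by simp
  have total1: "total X (Pr1 P A (One P) \<cdot> In1 Q B (One P))"
    using total_Comp[OF pr1' in1] Pr1_total In1_total by simp
  have n0: "?n0 \<in> Hom X (Prod P A B) (Prod P A ?S)" and n1: "?n1 \<in> Hom X (Prod P A (One P)) (Prod P A ?S)"
    using Pair_Hom[OF pr0 Comp_Hom[OF pr1 in0]] Pair_Hom[OF pr0' Comp_Hom[OF pr1' in1]]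
    by (simp_all add: id_times_def)
  have n0_pr: "?n0 \<cdot> Pr0 P A ?S = Pr0 P A B" "?n0 \<cdot> Pr1 P A ?S = Pr1 P A B \<cdot> In0 Q B (One P)"
    using Pair_Pr_total[OF pr0 Comp_Hom[OF pr1 in0]] total0 Pr0_total
    by (simp_all add: id_times_def)
  have n1_pr: "?n1 \<cdot> Pr0 P A ?S = Pr0 P A (One P)" "?n1 \<cdot> Pr1 P A ?S = Pr1 P A (One P) \<cdot> In1 Q B (One P)"
    using Pair_Pr_total[OF pr0' Comp_Hom[OF pr1' in1]] total1 Pr0_total
    by (simp_all add: id_times_def)
  note r = retraction_Hom[OF B]
  note Pr1S = Pr1_Hom[OF A S] and Pr0S = Pr0_Hom[OF A S]
  have "?n0 \<cdot> (Pr1 P A ?S \<cdot> retraction B) = (Pr1 P A B \<cdot> In0 Q B (One P)) \<cdot> retraction B"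
    using Comp_assoc[OF n0 Pr1S r, symmetric] unfolding n0_pr(2) .
  also have "\<dots> = Pr1 P A B" by simp
  finally have "?n0 \<cdot> ?w = \<rho> (Pr1 P A B) \<cdot> Pr0 P A B"
    using Comp_Rst_Comp[OF n0 Comp_Hom[OF Pr1S r] Pr0S] n0_pr by simp
  then have w0: "?n0 \<cdot> ?w = Pr0 P A B"
    using Pr1_total[OF A B] by (simp add: total_def)
  have "?n1 \<cdot> (Pr1 P A ?S \<cdot> retraction B) = (Pr1 P A (One P) \<cdot> In1 Q B (One P)) \<cdot> retraction B"
    using Comp_assoc[OF n1 Pr1S r, symmetric] unfolding n1_pr(2) .
  also have "\<dots> = z (Prod P A (One P)) B" by simp
  finally have w1: "?n1 \<cdot> ?w = z (Prod P A (One P)) A"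
    using Comp_Rst_Comp[OF n1 Comp_Hom[OF Pr1S r] Pr0S] n1_pr by simp
  have "distributor X P Q A B (One P) \<cdot> ?w = Copair Q (?n0 \<cdot> ?w) (?n1 \<cdot> ?w)"
    unfolding distributor_def using n0 n1 by (intro Copair_Comp) (auto simp: Hom_iff)
  then show ?thesis unfolding w0 w1 .
qed

abbreviation Tot :: "('o, 'a) category" where
  "Tot \<equiv> total_subcategory X"

lemma Hom_kleisli_Tot_iff:
  "h \<in> Hom (kleisli Tot P Q) A B \<longleftrightarrow>
     B \<in> Obj X \<and> (\<exists>f. f \<in> Hom X A (Sum Q B (One P)) \<and> total X f \<and> h = (f, B))"
  by (auto simp: Hom_kleisli_iff Hom_total_subcategory_iff)

definition partial_map :: "'a \<times> 'o \<Rightarrow> 'a" where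
  "partial_map h = fst h \<cdot> retraction (snd h)"

text \<open>
  The Kleisli restriction of \<open>f\<close> represents \<open>\<langle>1, f\<rangle>\<close> followed by the inverse distributor and
  \<open>[\<pi>\<^sub>0, 0]\<close>. By \<open>distributor_Rst_retraction\<close> the last two steps are the restriction of \<open>\<pi>\<^sub>0\<close>
  to the domain of \<open>\<pi>\<^sub>1 [1, 0]\<close>, whose pullback along \<open>\<langle>1, f\<rangle>\<close> is the identity
  restricted to the domain of \<open>f [1, 0]\<close>.
\<close>

lemma partial_map_Rst:
  assumes f: "f \<in> Hom X A (Sum Q B (One P))" and total: "total X f" and B: "B \<in> Obj X"
  shows "partial_map (Rst (kleisli Tot P Q) (f, B)) = \<rho> (partial_map (f, B))"
proof -
  interpret Tot: distributive_category Tot P Q by (rule distributive_total_subcategory)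
  have A: "A \<in> Obj X" using f by (auto simp: Hom_iff)
  note [simp] = A B
  let ?S = "Sum Q B (One P)"
  let ?d = "distributor X P Q A B (One P)" and ?u = "inv_arrow Tot (distributor Tot P Q A B (One P))"
  let ?w = "\<rho> (Pr1 P A ?S \<cdot> retraction B) \<cdot> Pr0 P A ?S"
  let ?s = "Copair Q (Pr0 P A B \<cdot> In0 Q A (One P)) (Pr1 P A (One P) \<cdot> In1 Q A (One P))"
  let ?q = "Pair P (Id X A) f"
  have S: "?S \<in> Obj X" by simp
  note r = retraction_Hom[OF B]
  note Pr1S = Pr1_Hom[OF A S] and Pr0S = Pr0_Hom[OF A S]
  have f': "f \<in> Hom Tot A ?S" using f total by (simp add: Hom_total_subcategory_iff)
  have u: "?u \<in> Hom X (Prod P A ?S) (Sum Q (Prod P A B) (Prod P A (One P)))"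
    using Tot.undist_Arr[of A B "One P"]
    by (simp add: Hom_iff total_subcategory_def)
  have d: "?d \<in> Hom X (Sum Q (Prod P A B) (Prod P A (One P))) (Prod P A ?S)"
    using Tot.distributor_Arr[of A B "One P"]
    by (simp add: distributor_total_subcategory Hom_total_subcategory_iff)
  have ud: "?u \<cdot> ?d = Id X (Prod P A ?S)"
    using Tot.undist_distributor[of A B "One P"] by (simp add: distributor_total_subcategory)
  have w: "?w \<in> Hom X (Prod P A ?S) A"
    by (simp add: Hom_iff)
  have q: "?q \<in> Hom X A (Prod P A ?S)" using Pair_Hom[OF Id_Hom[OF A] f] .
  have "?u \<cdot> (?s \<cdot> retraction A) = ?u \<cdot> (?d \<cdot> ?w)"
    unfolding distributor_Rst_retraction[OF A B] by simp
  also have "\<dots> = ?w"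
    using Comp_assoc[OF u d w] Id_left[OF w] ud by simp
  finally have us: "?u \<cdot> (?s \<cdot> retraction A) = ?w" .
  have "partial_map (Rst (kleisli Tot P Q) (f, B)) = (?q \<cdot> (?u \<cdot> ?s)) \<cdot> retraction A"
    by (simp add: Tot.Rst_kleisli[OF f'] partial_map_def del: Copair_Comp Comp_assoc_Arr)
  also have "\<dots> = ?q \<cdot> (?u \<cdot> (?s \<cdot> retraction A))"
    using q u by (simp add: Hom_iff del: Copair_Comp)
  also have "\<dots> = \<rho> (?q \<cdot> (Pr1 P A ?S \<cdot> retraction B)) \<cdot> (?q \<cdot> Pr0 P A ?S)"
    unfolding us using Comp_Rst_Comp[OF q Comp_Hom[OF Pr1S r] Pr0S] .
  also have "?q \<cdot> (Pr1 P A ?S \<cdot> retraction B) = f \<cdot> retraction B"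
    using Comp_assoc[OF q Pr1S r] Pair_Pr_total(2)[OF Id_Hom[OF A] f] by simp
  also have "?q \<cdot> Pr0 P A ?S = Id X A"
    using Pair_Pr_total(1)[OF Id_Hom[OF A] f total] .
  also have "\<rho> (f \<cdot> retraction B) \<cdot> Id X A = \<rho> (f \<cdot> retraction B)"
    using f by (simp add: Hom_iff)
  finally show ?thesis by (simp add: partial_map_def)
qed

lemma partial_map_faithful:
  assumes h: "h \<in> Hom (kleisli Tot P Q) A B" "h' \<in> Hom (kleisli Tot P Q) A B"
    and "partial_map h = partial_map h'"
  shows "h = h'"
proof -
  obtain f f' where f: "f \<in> Hom X A (Sum Q B (One P))" "total X f" "h = (f, B)"
    and f': "f' \<in> Hom X A (Sum Q B (One P))" "total X f'" "h' = (f', B)" and B: "B \<in> Obj X"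
    using h by (auto simp: Hom_kleisli_Tot_iff)
  have "f \<cdot> retraction B = f' \<cdot> retraction B" using assms(3) f f' by (simp add: partial_map_def)
  then have "f = f'"
    using classifies[OF Comp_Hom[OF f(1) retraction_Hom[OF B]]] f f' by auto
  then show ?thesis using f f' by simp
qed

lemma partial_map_full:
  assumes "f \<in> Hom X A B"
  shows "\<exists>h\<in>Hom (kleisli Tot P Q) A B. partial_map h = f"
proof -
  obtain T where "T \<in> Hom X A (Sum Q B (One P))" "total X T" "T \<cdot> retraction B = f"
    using classifies[OF assms] by blast
  moreover have "B \<in> Obj X" using assms by (auto simp: Hom_iff)
  ultimately show ?thesis
    by (intro bexI[of _ "(T, B)"]) (auto simp: Hom_kleisli_Tot_iff partial_map_def)
qed

lemma partial_map_functor: "restriction_functor (kleisli Tot P Q) X id partial_map"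
proof (rule reflect_restriction_functor)
  interpret Tot: distributive_category Tot P Q by (rule distributive_total_subcategory)
  let ?K = "kleisli Tot P Q"
  show "restriction_category X" by unfold_locales
  show "Dom ?K h \<in> Obj ?K" "Cod ?K h \<in> Obj ?K" if "h \<in> Arr ?K" for h
    using that Tot.Dom_Obj by (cases h; simp add: total_subcategory_def)+
  show "Id ?K A \<in> Hom ?K A A" if "A \<in> Obj ?K" for A
    using that In0_total[of A "One P"] by (simp add: Hom_kleisli_Tot_iff Hom_iff)
  show "Comp ?K g h \<in> Hom ?K A E" "partial_map (Comp ?K g h) = partial_map g \<cdot> partial_map h"
    if gh: "g \<in> Hom ?K A B" "h \<in> Hom ?K B E" for g h A B E
  proof -
    obtain g' h' where g: "g' \<in> Hom X A (Sum Q B (One P))" "total X g'" "g = (g', B)"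
      and h: "h' \<in> Hom X B (Sum Q E (One P))" "total X h'" "h = (h', E)"
      and BE: "B \<in> Obj X" "E \<in> Obj X"
      using gh by (auto simp: Hom_kleisli_Tot_iff)
    note in1 = In1_Hom[OF BE(2) One_Obj]
    have "total X (Copair Q h' (In1 Q E (One P)))"
      using Copair_total[OF h(1) in1 h(2)] In1_total BE by simp
    then show "Comp ?K g h \<in> Hom ?K A E"
      using total_Comp[OF g(1) Copair_Hom[OF h(1) in1] g(2)] Comp_Hom[OF g(1) Copair_Hom[OF h(1) in1]] g h BE
      by (simp add: Hom_kleisli_Tot_iff)
    show "partial_map (Comp ?K g h) = partial_map g \<cdot> partial_map h"
      using g h BE by (simp add: partial_map_def Hom_iff)
  qed
  show "Rst ?K h \<in> Hom ?K A A" "partial_map (Rst ?K h) = \<rho> (partial_map h)" "partial_map h \<in> Hom X (id A) (id B)"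
    if h: "h \<in> Hom ?K A B" for h A B
  proof -
    obtain f where f: "f \<in> Hom X A (Sum Q B (One P))" "total X f" "h = (f, B)" and B: "B \<in> Obj X"
      using h by (auto simp: Hom_kleisli_Tot_iff)
    have f': "f \<in> Hom Tot A (Sum Q B (One P))"
      using f by (simp add: Hom_total_subcategory_iff)
    show "partial_map (Rst ?K h) = \<rho> (partial_map h)"
      using partial_map_Rst[OF f(1,2) B] f by simp
    show "partial_map h \<in> Hom X (id A) (id B)"
      using Comp_Hom[OF f(1) retraction_Hom[OF B]] f by (simp add: partial_map_def)
    show "Rst ?K h \<in> Hom ?K A A"
      using Tot.Rst_kleisli_Hom[OF f'] B f by simp
  qed
  show "partial_map (Id ?K A) = Id X (id A)" if "A \<in> Obj ?K" for A
    using that by (simp add: partial_map_def)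
  show "id A \<in> Obj X" if "A \<in> Obj ?K" for A using that by simp
  show "h = h'" if "h \<in> Hom ?K A B" "h' \<in> Hom ?K A B" "partial_map h = partial_map h'" for h h' A B
    using partial_map_faithful that by blast
qed

lemma restriction_equivalent_kleisli_total: "restriction_equivalent X (kleisli Tot P Q)"
  by (rule restriction_equivalent_of_bijective_functor[OF partial_map_functor])
    (use partial_map_faithful partial_map_full in auto)

end

section \<open>The characterisation\<close>

lemma classically_classified_if_kleisli:
  assumes X: "distributive_restriction_category X P Q"
    and D: "distributive_category D P' Q'" and equiv: "restriction_equivalent X (kleisli D P' Q')"
  shows "classically_classified X P Q"
proof -
  interpret D: distributive_category D P' Q' by fact
  obtain Fo Fa where F: "restriction_weak_equivalence X (kleisli D P' Q') Fo Fa"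
    using restriction_equivalent_weak_equivalence[OF equiv] by blast
  then interpret F: restriction_weak_equivalence X "kleisli D P' Q'" Fo Fa .
  have "restriction_category (kleisli D P' Q')" by unfold_locales
  note D.kleisli_classifying_coproducts[OF this]
  with X F show ?thesis
    by (intro classification_transport.classically_classified classification_transport.intro)
qed

theorem corollary7p12:
  fixes X :: "('o, 'a) restriction_category"
    and P :: "('o, 'a) products" and Q :: "('o, 'a) coproducts"
  assumes "distributive_restriction_category X P Q"
  shows "(classically_classified X P Q \<longleftrightarrow>
           (\<exists>(D :: ('o, 'a) category) P' Q'.
              distributive_category D P' Q' \<and> restriction_equivalent X (kleisli D P' Q')))
       \<and> (\<forall>(D :: ('p, 'b) category) P' Q'.
            distributive_category D P' Q' \<and> restriction_equivalent X (kleisli D P' Q')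
              \<longrightarrow> classically_classified X P Q)"
proof (intro conjI iffI allI impI)
  interpret X: distributive_restriction_category X P Q by fact
  assume "classically_classified X P Q"
  then obtain z where z: "restriction_zeroes X z"
    "\<forall>A\<in>Obj X. \<forall>B\<in>Obj X. \<forall>f\<in>Hom X A B. \<exists>!T. T \<in> Hom X A (Sum Q B (One P)) \<and> total X T \<and>
       T \<cdot>\<^bsub>X\<^esub> Copair Q (Id X B) (z (One P) B) = f"
    unfolding classically_classified_def by blast
  have "Dom X f \<in> Obj X \<and> Cod X f \<in> Obj X" if "f \<in> Arr X" for f
    using that by simp
  with z interpret classified_restriction_category X P Q z
    by unfold_locales (auto simp: Hom_iff)
  show "\<exists>(D :: ('o, 'a) category) P' Q'.
      distributive_category D P' Q' \<and> restriction_equivalent X (kleisli D P' Q')"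
    using X.distributive_total_subcategory restriction_equivalent_kleisli_total by blast
qed (use classically_classified_if_kleisli[OF assms] in blast)+

end
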